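(* Let $S=\begin{pmatrix}0&1\\2&0\end{pmatrix}$ acting on $\mathbb{Q}_2^2$, and let $\theta:\mathbb{Q}_2^2\to\mathbb{R}$ be $$\theta(x)=\Omega\left(|S^{-1}x|_2\right)-\Omega\left(\left|S^{-1}x-\begin{pmatrix}1/2\\0\end{pmatrix}\right|_2\right).$$ Then the set of functions $\theta_{jn}(x)=2^{j/2}\,\theta(S^{-j}x-n)$, $j\in\mathbb{Z}$, $n\in\mathbb{Q}_2^2/\mathbb{Z}_2^2$, is an orthonormal basis of $L^2(\mathbb{Q}_2^2)$.
   Context: $|x|_2=\max(|x_1|_2,|x_2|_2)$ for $x=(x_1,x_2)\in\mathbb{Q}_2^2$. $\Omega$ is the characteristic function of the interval $[0,1]$. $L^2(\mathbb{Q}_2^2)$ is taken with respect to the Haar measure normalized so that $\mathbb{Z}_2^2$ has measure one. An element $n\in\mathbb{Q}_2^2/\mathbb{Z}_2^2$ is understood as its fixed representative $n=(n_1,n_2)$ with $n_i=\sum_{m=\beta_i}^{-1}n^{(i)}_m2^m$, $n^{(i)}_m\in\{0,1\}$. *)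

theory Defs
  imports "HOL-Analysis.Analysis" "HOL-Computational_Algebra.Factorial_Ring"
begin

section \<open>The 2-adic absolute value on the rationals\<close>

definition abs2_rat :: "rat \<Rightarrow> real" where
  "abs2_rat x = (if x = 0 then 0 else
     2 powi (int (multiplicity 2 (snd (quotient_of x))) - int (multiplicity 2 (fst (quotient_of x)))))"

lemma abs2_rat_zero [simp]: "abs2_rat 0 = 0"
  by (simp add: abs2_rat_def)

lemma abs2_rat_divide:
  fixes a b :: int
  assumes "a \<noteq> 0" "b \<noteq> 0"
  shows "abs2_rat (of_int a / of_int b) = 2 powi (int (multiplicity 2 b) - int (multiplicity 2 a))"
proof -
  define x :: rat where "x = of_int a / of_int b"
  obtain p q where pq: "quotient_of x = (p, q)" by force
  have q: "q > 0" using quotient_of_denom_pos[OF pq] .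
  have x: "x = of_int p / of_int q" using quotient_of_div[OF pq] .
  have x0: "x \<noteq> 0" using assms by (simp add: x_def)
  then have p: "p \<noteq> 0" using x by auto
  have "(of_int (a * q) :: rat) = of_int (p * b)"
    using x assms q unfolding x_def by (simp add: field_simps)
  then have "a * q = p * b" by (simp only: of_int_eq_iff)
  then have "multiplicity 2 (a * q) = multiplicity 2 (p * b)" by simp
  then have "multiplicity 2 a + multiplicity 2 q = multiplicity 2 p + multiplicity 2 b"
    using p q assms by (simp add: prime_elem_multiplicity_mult_distrib)
  then have "int (multiplicity 2 q) - int (multiplicity 2 p) = int (multiplicity 2 b) - int (multiplicity 2 a)"
    by linarith
  then show ?thesis
    using x0 pq by (simp add: abs2_rat_def x_def [symmetric])
qed

lemma rat_frac_cases:
  fixes x :: rat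
  obtains a b :: int where "x = of_int a / of_int b" "b \<noteq> 0"
proof -
  obtain p q where pq: "quotient_of x = (p, q)" by force
  show ?thesis
    using that quotient_of_div[OF pq] quotient_of_denom_pos[OF pq] by auto
qed

lemma abs2_rat_eq_0 [simp]: "abs2_rat x = 0 \<longleftrightarrow> x = 0"
  by (simp add: abs2_rat_def power_int_eq_0_iff)

lemma abs2_rat_nonneg [simp]: "0 \<le> abs2_rat x"
  by (simp add: abs2_rat_def)

lemma abs2_rat_pos: "x \<noteq> 0 \<Longrightarrow> 0 < abs2_rat x"
  by (simp add: abs2_rat_def)

lemma abs2_rat_one [simp]: "abs2_rat 1 = 1"
  using abs2_rat_divide[of 1 1] by simp

lemma abs2_rat_two [simp]: "abs2_rat 2 = 1 / 2"
  using abs2_rat_divide[of 2 1] by (simp add: multiplicity_self power_int_minus)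

lemma abs2_rat_mult: "abs2_rat (x * y) = abs2_rat x * abs2_rat y"
proof -
  obtain a b where x: "x = of_int a / of_int b" "b \<noteq> 0" by (rule rat_frac_cases)
  obtain c d where y: "y = of_int c / of_int d" "d \<noteq> 0" by (rule rat_frac_cases)
  show ?thesis
  proof (cases "a = 0 \<or> c = 0")
    case True
    then show ?thesis using x y by auto
  next
    case False
    have "abs2_rat (x * y) = abs2_rat (of_int (a * c) / of_int (b * d))"
      by (simp add: x y)
    also have "\<dots> = 2 powi (int (multiplicity 2 (b * d)) - int (multiplicity 2 (a * c)))"
      using False x y by (intro abs2_rat_divide) auto
    also have "\<dots> = 2 powi ((int (multiplicity 2 b) - int (multiplicity 2 a))
                        + (int (multiplicity 2 d) - int (multiplicity 2 c)))"
      using False x y by (simp add: prime_elem_multiplicity_mult_distrib algebra_simps)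
    also have "\<dots> = abs2_rat x * abs2_rat y"
      using False x y by (simp add: power_int_add abs2_rat_divide)
    finally show ?thesis .
  qed
qed

lemma abs2_rat_inverse: "abs2_rat (inverse x) = inverse (abs2_rat x)"
proof (cases "x = 0")
  case False
  have "abs2_rat x * abs2_rat (inverse x) = 1"
    using False by (simp flip: abs2_rat_mult)
  then show ?thesis by (simp add: inverse_unique)
qed simp

lemma abs2_rat_divide_eq: "abs2_rat (x / y) = abs2_rat x / abs2_rat y"
  by (simp add: divide_inverse abs2_rat_mult abs2_rat_inverse)

lemma abs2_rat_minus [simp]: "abs2_rat (- x) = abs2_rat x"
proof -
  have "abs2_rat (-1) * abs2_rat (-1) = 1" by (simp flip: abs2_rat_mult)
  then have "abs2_rat (-1) = 1"
    using abs2_rat_nonneg[of "-1"] by (metis power2_eq_1_iff power2_eq_square le_minus_one_simps(3))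
  then show ?thesis using abs2_rat_mult[of "-1" x] by simp
qed

lemma abs2_rat_minus_commute: "abs2_rat (x - y) = abs2_rat (y - x)"
  using abs2_rat_minus[of "x - y"] by simp

lemma abs2_rat_of_int_le: "abs2_rat (of_int a) \<le> 1"
proof (cases "a = 0")
  case False
  then have "abs2_rat (of_int a) = 2 powi (- int (multiplicity 2 a))"
    using abs2_rat_divide[of a 1] by simp
  also have "\<dots> \<le> 1" by (simp add: power_int_minus field_simps)
  finally show ?thesis .
qed simp

lemma abs2_rat_one_add_le:
  assumes "abs2_rat x \<le> 1"
  shows "abs2_rat (1 + x) \<le> 1"
proof -
  obtain p q where pq: "quotient_of x = (p, q)" by force
  have q: "q > 0" using quotient_of_denom_pos[OF pq] .
  have x: "x = of_int p / of_int q" using quotient_of_div[OF pq] .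
  have co: "coprime p q" using quotient_of_coprime[OF pq] .
  show ?thesis
  proof (cases "p = 0 \<or> q + p = 0")
    case True
    then have "p = 0 \<or> p = - q" by linarith
    then have "x = 0 \<or> 1 + x = 0" using q x by auto
    then show ?thesis by auto
  next
    case False
    have "multiplicity 2 q = 0"
    proof (rule ccontr)
      assume *: "multiplicity 2 q \<noteq> 0"
      then have "even q" by (auto intro: ccontr simp: not_dvd_imp_multiplicity_0)
      then have "odd p" using coprime_common_divisor[OF co, of 2] by auto
      then have "multiplicity 2 p = 0" by (rule not_dvd_imp_multiplicity_0)
      then have "abs2_rat x = 2 powi int (multiplicity 2 q)"
        using False q x by (simp add: abs2_rat_divide)
      also have "\<dots> > 1" using * by simp
      finally show False using assms by simp
    qed
    moreover have "1 + x = of_int (q + p) / of_int q" using q by (simp add: x add_divide_distrib)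
    then have "abs2_rat (1 + x) = 2 powi (int (multiplicity 2 q) - int (multiplicity 2 (q + p)))"
      using False q abs2_rat_divide[of "q + p" q] by simp
    ultimately have "abs2_rat (1 + x) = 2 powi (- int (multiplicity 2 (q + p)))" by simp
    also have "\<dots> \<le> 1" by (simp add: power_int_minus field_simps)
    finally show ?thesis .
  qed
qed

lemma abs2_rat_ultrametric: "abs2_rat (x + y) \<le> max (abs2_rat x) (abs2_rat y)"
proof -
  have *: "abs2_rat (x + y) \<le> abs2_rat x" if "abs2_rat y \<le> abs2_rat x" for x y
  proof (cases "x = 0")
    case True
    then have "abs2_rat y = 0" using that abs2_rat_nonneg[of y] abs2_rat_zero by (metis order_antisym)
    then show ?thesis using True by simp
  next
    case False
    have "abs2_rat (y / x) \<le> 1"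
      using that abs2_rat_pos[OF False]
      by (simp add: abs2_rat_divide_eq)
    then have "abs2_rat (1 + y / x) \<le> 1" by (rule abs2_rat_one_add_le)
    moreover have "x + y = x * (1 + y / x)" using False by (simp add: field_simps)
    then have "abs2_rat (x + y) = abs2_rat x * abs2_rat (1 + y / x)"
      by (simp only: abs2_rat_mult)
    ultimately show ?thesis by (simp add: mult_left_le)
  qed
  show ?thesis using *[of y x] *[of x y] by (cases "abs2_rat y \<le> abs2_rat x") (simp_all add: add.commute max_def)
qed

lemma abs2_rat_triangle: "abs2_rat (x + y) \<le> abs2_rat x + abs2_rat y"
  using abs2_rat_ultrametric[of x y] abs2_rat_nonneg[of x] abs2_rat_nonneg[of y] by linarith

lemma abs2_rat_triangle_diff: "abs2_rat (x - z) \<le> abs2_rat (x - y) + abs2_rat (y - z)"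
  using abs2_rat_triangle[of "x - y" "y - z"] by simp

lemma abs2_rat_reverse: "\<bar>abs2_rat x - abs2_rat y\<bar> \<le> abs2_rat (x - y)"
  using abs2_rat_triangle[of "x - y" y] abs2_rat_triangle[of "y - x" x]
    abs2_rat_minus_commute[of x y] by (simp add: abs_le_iff)


section \<open>The field of 2-adic numbers as the completion of the rationals\<close>

definition cauchy2 :: "(nat \<Rightarrow> rat) \<Rightarrow> bool" where
  "cauchy2 X \<longleftrightarrow> (\<forall>e>0. \<exists>N. \<forall>m\<ge>N. \<forall>n\<ge>N. abs2_rat (X m - X n) < e)"

definition vanishes2 :: "(nat \<Rightarrow> rat) \<Rightarrow> bool" where
  "vanishes2 X \<longleftrightarrow> (\<lambda>n. abs2_rat (X n)) \<longlonglongrightarrow> 0"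

definition q2rel :: "(nat \<Rightarrow> rat) \<Rightarrow> (nat \<Rightarrow> rat) \<Rightarrow> bool" where
  "q2rel X Y \<longleftrightarrow> cauchy2 X \<and> cauchy2 Y \<and> vanishes2 (\<lambda>n. X n - Y n)"

lemma cauchy2_const [simp]: "cauchy2 (\<lambda>n. c)"
  by (simp add: cauchy2_def)

lemma vanishes2_const [simp]: "vanishes2 (\<lambda>n. c) \<longleftrightarrow> c = 0"
  by (simp add: vanishes2_def LIMSEQ_const_iff)

lemma vanishes2_bound:
  assumes "g \<longlonglongrightarrow> 0" "\<forall>\<^sub>F n in sequentially. abs2_rat (X n) \<le> g n"
  shows "vanishes2 X"
  unfolding vanishes2_def
  by (rule tendsto_sandwich[OF _ assms(2) tendsto_const assms(1)]) simp

lemma vanishes2_add: "vanishes2 X \<Longrightarrow> vanishes2 Y \<Longrightarrow> vanishes2 (\<lambda>n. X n + Y n)"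
  unfolding vanishes2_def[of X] vanishes2_def[of Y]
  by (rule vanishes2_bound[of "\<lambda>n. abs2_rat (X n) + abs2_rat (Y n)"])
     (auto intro!: tendsto_add_zero always_eventually abs2_rat_triangle)

lemma vanishes2_minus: "vanishes2 X \<Longrightarrow> vanishes2 (\<lambda>n. - X n)"
  by (simp add: vanishes2_def)

lemma cauchy2_bound:
  assumes "cauchy2 X" "cauchy2 Y"
    "\<And>m n. abs2_rat (Z m - Z n) \<le> A * abs2_rat (X m - X n) + B * abs2_rat (Y m - Y n)"
    "A \<ge> 0" "B \<ge> 0"
  shows "cauchy2 Z"
  unfolding cauchy2_def
proof (intro allI impI)
  fix e :: real assume e: "e > 0"
  define d where "d = e / (A + B + 1)"
  have d: "d > 0" using e assms by (simp add: d_def)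
  obtain N where N: "\<And>m n. m \<ge> N \<Longrightarrow> n \<ge> N \<Longrightarrow> abs2_rat (X m - X n) < d"
    using assms(1) d unfolding cauchy2_def by blast
  obtain M where M: "\<And>m n. m \<ge> M \<Longrightarrow> n \<ge> M \<Longrightarrow> abs2_rat (Y m - Y n) < d"
    using assms(2) d unfolding cauchy2_def by blast
  have "abs2_rat (Z m - Z n) < e" if "m \<ge> max N M" "n \<ge> max N M" for m n
  proof -
    have "abs2_rat (Z m - Z n) \<le> A * abs2_rat (X m - X n) + B * abs2_rat (Y m - Y n)"
      by (rule assms(3))
    also have "\<dots> \<le> A * d + B * d"
      using N[of m n] M[of m n] that assms by (intro add_mono mult_left_mono) auto
    also have "\<dots> < (A + B + 1) * d" using d by (simp add: algebra_simps)
    also have "\<dots> = e" using assms by (simp add: d_def)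
    finally show ?thesis .
  qed
  then show "\<exists>N. \<forall>m\<ge>N. \<forall>n\<ge>N. abs2_rat (Z m - Z n) < e" by blast
qed

lemma cauchy2_add: "cauchy2 X \<Longrightarrow> cauchy2 Y \<Longrightarrow> cauchy2 (\<lambda>n. X n + Y n)"
  by (erule (1) cauchy2_bound[where A = 1 and B = 1])
     (simp_all only: add_diff_add mult_1 abs2_rat_triangle zero_le_one)

lemma cauchy2_minus: "cauchy2 X \<Longrightarrow> cauchy2 (\<lambda>n. - X n)"
  by (simp add: cauchy2_def abs2_rat_minus_commute)

lemma cauchy2_abs_Cauchy:
  assumes "cauchy2 X" shows "Cauchy (\<lambda>n. abs2_rat (X n))"
  unfolding Cauchy_def
proof (intro allI impI)
  fix e :: real assume "e > 0"
  then obtain N where "\<forall>m\<ge>N. \<forall>n\<ge>N. abs2_rat (X m - X n) < e"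
    using assms unfolding cauchy2_def by blast
  then show "\<exists>M. \<forall>m\<ge>M. \<forall>n\<ge>M. dist (abs2_rat (X m)) (abs2_rat (X n)) < e"
    unfolding dist_real_def by (blast intro: order_le_less_trans[OF abs2_rat_reverse])
qed

lemma cauchy2_abs_LIMSEQ:
  "cauchy2 X \<Longrightarrow> (\<lambda>n. abs2_rat (X n)) \<longlonglongrightarrow> lim (\<lambda>n. abs2_rat (X n))"
  using cauchy2_abs_Cauchy Cauchy_convergent_iff convergent_LIMSEQ_iff by blast

lemma cauchy2_imp_bounded:
  assumes "cauchy2 X" shows "\<exists>B>0. \<forall>n. abs2_rat (X n) \<le> B"
proof -
  have "Bseq (\<lambda>n. abs2_rat (X n))"
    using Cauchy_Bseq cauchy2_abs_Cauchy[OF assms] by blast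
  then show ?thesis by (auto simp: Bseq_def)
qed

lemma cauchy2_mult:
  assumes "cauchy2 X" "cauchy2 Y" shows "cauchy2 (\<lambda>n. X n * Y n)"
proof -
  obtain A where A: "A > 0" "\<And>n. abs2_rat (X n) \<le> A" using cauchy2_imp_bounded[OF assms(1)] by blast
  obtain B where B: "B > 0" "\<And>n. abs2_rat (Y n) \<le> B" using cauchy2_imp_bounded[OF assms(2)] by blast
  show ?thesis
  proof (rule cauchy2_bound[OF assms])
    fix m n
    have "X m * Y m - X n * Y n = Y m * (X m - X n) + X n * (Y m - Y n)" by (simp add: algebra_simps)
    then have "abs2_rat (X m * Y m - X n * Y n)
      \<le> abs2_rat (Y m) * abs2_rat (X m - X n) + abs2_rat (X n) * abs2_rat (Y m - Y n)"
      using abs2_rat_triangle[of "Y m * (X m - X n)" "X n * (Y m - Y n)"]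
      by (simp only: abs2_rat_mult)
    also have "\<dots> \<le> B * abs2_rat (X m - X n) + A * abs2_rat (Y m - Y n)"
      using A B by (intro add_mono mult_right_mono) auto
    finally show "abs2_rat (X m * Y m - X n * Y n) \<le> \<dots>" .
  qed (use A B in auto)
qed

lemma vanishes2_mult_bounded:
  assumes "cauchy2 X" "vanishes2 Y" shows "vanishes2 (\<lambda>n. X n * Y n)"
proof -
  obtain A where A: "A > 0" "\<And>n. abs2_rat (X n) \<le> A" using cauchy2_imp_bounded[OF assms(1)] by blast
  show ?thesis
  proof (rule vanishes2_bound)
    show "(\<lambda>n. A * abs2_rat (Y n)) \<longlonglongrightarrow> 0"
      using assms(2) unfolding vanishes2_def by (rule tendsto_mult_right_zero)
    show "\<forall>\<^sub>F n in sequentially. abs2_rat (X n * Y n) \<le> A * abs2_rat (Y n)"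
      using A by (intro always_eventually allI) (simp add: abs2_rat_mult mult_right_mono)
  qed
qed

lemma cauchy2_not_vanishes:
  assumes "cauchy2 X" "\<not> vanishes2 X"
  shows "\<exists>b>0. \<exists>N. \<forall>n\<ge>N. b < abs2_rat (X n)"
proof -
  define L where "L = lim (\<lambda>n. abs2_rat (X n))"
  have L: "(\<lambda>n. abs2_rat (X n)) \<longlonglongrightarrow> L"
    unfolding L_def by (rule cauchy2_abs_LIMSEQ[OF assms(1)])
  then have "L \<ge> 0" by (rule LIMSEQ_le_const) simp
  moreover have "L \<noteq> 0" using L assms(2) by (auto simp: vanishes2_def)
  ultimately have "L > 0" by simp
  then have "\<forall>\<^sub>F n in sequentially. L / 2 < abs2_rat (X n)"
    by (intro order_tendstoD[OF L]) simp
  then have "\<exists>N. \<forall>n\<ge>N. L / 2 < abs2_rat (X n)" by (simp only: eventually_sequentially)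
  then show ?thesis using \<open>L > 0\<close> by (intro exI[of _ "L / 2"] conjI) simp_all
qed

lemma abs2_rat_inverse_diff:
  assumes "0 < b" "b < abs2_rat x" "b < abs2_rat y"
  shows "abs2_rat (inverse x - inverse y) \<le> abs2_rat (x - y) / (b * b)"
proof -
  have "x \<noteq> 0" "y \<noteq> 0" using assms by auto
  then have "inverse x - inverse y = (y - x) / (x * y)" by (simp add: field_simps)
  then have "abs2_rat (inverse x - inverse y) = abs2_rat (x - y) / (abs2_rat x * abs2_rat y)"
    by (simp add: abs2_rat_divide_eq abs2_rat_mult abs2_rat_minus_commute[of x])
  also have "\<dots> \<le> abs2_rat (x - y) / (b * b)"
    using assms by (intro divide_left_mono mult_mono) (auto intro!: mult_pos_pos)
  finally show ?thesis .
qed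

lemma cauchy2_inverse:
  assumes "cauchy2 X" "\<not> vanishes2 X"
  shows "cauchy2 (\<lambda>n. inverse (X n))"
  unfolding cauchy2_def
proof (intro allI impI)
  fix e :: real assume e: "e > 0"
  obtain b N where b: "b > 0" "\<And>n. n \<ge> N \<Longrightarrow> b < abs2_rat (X n)"
    using cauchy2_not_vanishes[OF assms] by blast
  then have "e * (b * b) > 0" using e by simp
  then obtain M where M: "\<And>m n. m \<ge> M \<Longrightarrow> n \<ge> M \<Longrightarrow> abs2_rat (X m - X n) < e * (b * b)"
    using assms(1) unfolding cauchy2_def by blast
  have "abs2_rat (inverse (X m) - inverse (X n)) < e" if "m \<ge> max M N" "n \<ge> max M N" for m n
  proof -
    have "abs2_rat (inverse (X m) - inverse (X n)) \<le> abs2_rat (X m - X n) / (b * b)"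
      using b that by (intro abs2_rat_inverse_diff) auto
    also have "\<dots> < e" using M[of m n] that b by (simp add: pos_divide_less_eq)
    finally show ?thesis .
  qed
  then show "\<exists>N. \<forall>m\<ge>N. \<forall>n\<ge>N. abs2_rat (inverse (X m) - inverse (X n)) < e" by blast
qed

lemma vanishes2_diff_inverse:
  assumes "cauchy2 X" "\<not> vanishes2 X" "cauchy2 Y" "\<not> vanishes2 Y" "vanishes2 (\<lambda>n. X n - Y n)"
  shows "vanishes2 (\<lambda>n. inverse (X n) - inverse (Y n))"
proof -
  obtain b N where b: "b > 0" "\<And>n. n \<ge> N \<Longrightarrow> b < abs2_rat (X n)"
    using cauchy2_not_vanishes[OF assms(1,2)] by blast
  obtain c M where c: "c > 0" "\<And>n. n \<ge> M \<Longrightarrow> c < abs2_rat (Y n)"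
    using cauchy2_not_vanishes[OF assms(3,4)] by blast
  define d where "d = min b c"
  have d: "d > 0" "\<And>n. n \<ge> max N M \<Longrightarrow> d < abs2_rat (X n) \<and> d < abs2_rat (Y n)"
    using b c by (auto simp: d_def min_less_iff_disj)
  show ?thesis
  proof (rule vanishes2_bound)
    show "(\<lambda>n. abs2_rat (X n - Y n) / (d * d)) \<longlonglongrightarrow> 0"
      using assms(5) unfolding vanishes2_def by (rule tendsto_divide_zero)
    show "\<forall>\<^sub>F n in sequentially. abs2_rat (inverse (X n) - inverse (Y n)) \<le> abs2_rat (X n - Y n) / (d * d)"
      unfolding eventually_sequentially using d abs2_rat_inverse_diff by blast
  qed
qed

lemma q2rel_refl: "cauchy2 X \<Longrightarrow> q2rel X X"
  by (simp add: q2rel_def)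

lemma part_equivp_q2rel: "part_equivp q2rel"
proof (rule part_equivpI)
  show "\<exists>X. q2rel X X" by (rule exI[of _ "\<lambda>_. 0"]) (simp add: q2rel_refl)
  show "symp q2rel"
    by (rule sympI) (auto simp: q2rel_def vanishes2_def abs2_rat_minus_commute)
  show "transp q2rel"
  proof (rule transpI)
    fix X Y Z assume "q2rel X Y" "q2rel Y Z"
    then show "q2rel X Z"
      using vanishes2_add[of "\<lambda>n. X n - Y n" "\<lambda>n. Y n - Z n"] by (simp add: q2rel_def)
  qed
qed

quotient_type q2 = "nat \<Rightarrow> rat" / partial: q2rel
  morphisms rep_q2 Q2_of_seq
  by (rule part_equivp_q2rel)

lemma vanishes2_cong:
  assumes "vanishes2 (\<lambda>n. X n - Y n)"
  shows "vanishes2 X \<longleftrightarrow> vanishes2 Y"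
proof
  assume "vanishes2 X"
  from vanishes2_add[OF this vanishes2_minus[OF assms]] show "vanishes2 Y" by simp
next
  assume "vanishes2 Y"
  from vanishes2_add[OF this assms] show "vanishes2 X" by simp
qed

instantiation q2 :: field
begin

lift_definition zero_q2 :: q2 is "\<lambda>n. 0"
  by (simp add: q2rel_refl)

lift_definition one_q2 :: q2 is "\<lambda>n. 1"
  by (simp add: q2rel_refl)

lift_definition plus_q2 :: "q2 \<Rightarrow> q2 \<Rightarrow> q2" is "\<lambda>X Y n. X n + Y n"
  unfolding q2rel_def add_diff_add
  by (simp only: cauchy2_add vanishes2_add simp_thms)

lift_definition uminus_q2 :: "q2 \<Rightarrow> q2" is "\<lambda>X n. - X n"
  unfolding q2rel_def minus_diff_minus
  by (simp only: cauchy2_minus vanishes2_minus simp_thms)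

lift_definition times_q2 :: "q2 \<Rightarrow> q2 \<Rightarrow> q2" is "\<lambda>X Y n. X n * Y n"
proof -
  fix f1 f2 f3 f4
  have "\<lbrakk>cauchy2 f1; cauchy2 f4; vanishes2 (\<lambda>n. f1 n - f2 n); vanishes2 (\<lambda>n. f3 n - f4 n)\<rbrakk>
       \<Longrightarrow> vanishes2 (\<lambda>n. f1 n * (f3 n - f4 n) + f4 n * (f1 n - f2 n))"
    by (simp add: vanishes2_add vanishes2_mult_bounded)
  then show "\<lbrakk>q2rel f1 f2; q2rel f3 f4\<rbrakk> \<Longrightarrow> q2rel (\<lambda>n. f1 n * f3 n) (\<lambda>n. f2 n * f4 n)"
    by (simp add: mult.commute q2rel_def mult_diff_mult cauchy2_mult)
qed

lift_definition inverse_q2 :: "q2 \<Rightarrow> q2"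
  is "\<lambda>X. if vanishes2 X then (\<lambda>n. 0) else (\<lambda>n. inverse (X n))"
proof -
  fix X Y assume "q2rel X Y"
  then have *: "cauchy2 X" "cauchy2 Y" "vanishes2 (\<lambda>n. X n - Y n)"
    by (simp_all add: q2rel_def)
  have "vanishes2 X \<longleftrightarrow> vanishes2 Y" using *(3) by (rule vanishes2_cong)
  then show "q2rel (if vanishes2 X then \<lambda>n. 0 else (\<lambda>n. inverse (X n)))
                   (if vanishes2 Y then \<lambda>n. 0 else (\<lambda>n. inverse (Y n)))"
    using * by (auto simp: q2rel_def cauchy2_inverse vanishes2_diff_inverse)
qed

definition "x - y = x + - y" for x y :: q2

definition "x div y = x * inverse y" for x y :: q2

instance
proof
  fix a b c :: q2
  show "a + b = b + a"
    by transfer (simp add: ac_simps q2rel_def cauchy2_add)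
  show "(a + b) + c = a + (b + c)"
    by transfer (simp add: ac_simps q2rel_def cauchy2_add)
  show "0 + a = a"
    by transfer (simp add: q2rel_def)
  show "- a + a = 0"
    by transfer (simp add: q2rel_def)
  show "a - b = a + - b"
    by (rule minus_q2_def)
  show "(a * b) * c = a * (b * c)"
    by transfer (simp add: ac_simps q2rel_def cauchy2_mult)
  show "a * b = b * a"
    by transfer (simp add: ac_simps q2rel_def cauchy2_mult)
  show "1 * a = a"
    by transfer (simp add: q2rel_def)
  show "(a + b) * c = a * c + b * c"
    by transfer (simp add: distrib_right q2rel_def cauchy2_add cauchy2_mult)
  show "(0::q2) \<noteq> (1::q2)"
    by transfer (simp add: q2rel_def)
  have "vanishes2 (\<lambda>n. inverse (X n) * X n - 1)" if X: "cauchy2 X" "\<not> vanishes2 X" for X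
  proof -
    obtain b N where b: "b > 0" "\<And>n. n \<ge> N \<Longrightarrow> b < abs2_rat (X n)"
      using cauchy2_not_vanishes[OF X] by blast
    have "X n \<noteq> 0" if "n \<ge> N" for n
      using b(1) b(2)[OF that] by (metis abs2_rat_zero order.asym)
    then show ?thesis
      by (intro vanishes2_bound[of "\<lambda>_. 0"]) (auto simp: eventually_sequentially intro!: exI[of _ N])
  qed
  then show "a \<noteq> 0 \<Longrightarrow> inverse a * a = 1"
    by transfer (simp add: q2rel_def cauchy2_mult cauchy2_inverse)
  show "a div b = a * inverse b"
    by (rule divide_q2_def)
  show "inverse (0::q2) = 0"
    by transfer (simp add: q2rel_def)
qed

end

lift_definition abs2 :: "q2 \<Rightarrow> real" is "\<lambda>X. lim (\<lambda>n. abs2_rat (X n))"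
proof -
  fix X Y assume "q2rel X Y"
  then have *: "cauchy2 X" "cauchy2 Y" "(\<lambda>n. abs2_rat (X n - Y n)) \<longlonglongrightarrow> 0"
    by (simp_all add: q2rel_def vanishes2_def)
  have "(\<lambda>n. abs2_rat (X n) - abs2_rat (Y n)) \<longlonglongrightarrow> 0"
    by (rule Lim_null_comparison[OF _ *(3)]) (auto simp: abs2_rat_reverse)
  from tendsto_add[OF this cauchy2_abs_LIMSEQ[OF *(2)]]
  have "(\<lambda>n. abs2_rat (X n)) \<longlonglongrightarrow> lim (\<lambda>n. abs2_rat (Y n))" by simp
  then show "lim (\<lambda>n. abs2_rat (X n)) = lim (\<lambda>n. abs2_rat (Y n))"
    by (rule limI)
qed

lemma Q2_cases:
  obtains X where "cauchy2 X" "x = Q2_of_seq X"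
proof -
  have "q2rel (rep_q2 x) (rep_q2 x)" "Q2_of_seq (rep_q2 x) = x"
    using Quotient3_rep_reflp[OF Quotient3_q2] Quotient3_abs_rep[OF Quotient3_q2] by blast+
  then show ?thesis using that[of "rep_q2 x"] by (auto simp: q2rel_def)
qed

lemma Q2_eq_iff:
  "cauchy2 X \<Longrightarrow> cauchy2 Y \<Longrightarrow> Q2_of_seq X = Q2_of_seq Y \<longleftrightarrow> vanishes2 (\<lambda>n. X n - Y n)"
  using Quotient3_rel[OF Quotient3_q2, of X Y] by (auto simp: q2rel_def)

lemma abs2_LIMSEQ:
  assumes "cauchy2 X" shows "(\<lambda>n. abs2_rat (X n)) \<longlonglongrightarrow> abs2 (Q2_of_seq X)"
proof -
  have "abs2 (Q2_of_seq X) = lim (\<lambda>n. abs2_rat (X n))"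
    using assms by (intro abs2.abs_eq) (simp add: eq_onp_def q2rel_refl)
  then show ?thesis using cauchy2_abs_LIMSEQ[OF assms] by simp
qed

lemma Q2_add: "cauchy2 X \<Longrightarrow> cauchy2 Y \<Longrightarrow> Q2_of_seq X + Q2_of_seq Y = Q2_of_seq (\<lambda>n. X n + Y n)"
  by (rule plus_q2.abs_eq) (auto simp: eq_onp_def q2rel_refl)

lemma Q2_minus: "cauchy2 X \<Longrightarrow> - Q2_of_seq X = Q2_of_seq (\<lambda>n. - X n)"
  by (rule uminus_q2.abs_eq) (auto simp: eq_onp_def q2rel_refl)

lemma Q2_diff: "cauchy2 X \<Longrightarrow> cauchy2 Y \<Longrightarrow> Q2_of_seq X - Q2_of_seq Y = Q2_of_seq (\<lambda>n. X n - Y n)"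
  unfolding minus_q2_def by (simp add: Q2_add Q2_minus cauchy2_minus)

lemma Q2_mult: "cauchy2 X \<Longrightarrow> cauchy2 Y \<Longrightarrow> Q2_of_seq X * Q2_of_seq Y = Q2_of_seq (\<lambda>n. X n * Y n)"
  by (rule times_q2.abs_eq) (auto simp: eq_onp_def q2rel_refl)

lemma Q2_eq_0_iff: "cauchy2 X \<Longrightarrow> Q2_of_seq X = 0 \<longleftrightarrow> vanishes2 X"
  unfolding zero_q2_def by (simp add: Q2_eq_iff)

lemma abs2_nonneg [simp]: "0 \<le> abs2 x"
proof (cases x rule: Q2_cases)
  case (1 X)
  then show ?thesis using abs2_LIMSEQ[of X] by (auto intro: LIMSEQ_le_const)
qed

lemma abs2_eq_0 [simp]: "abs2 x = 0 \<longleftrightarrow> x = 0"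
proof (cases x rule: Q2_cases)
  case (1 X)
  then show ?thesis using abs2_LIMSEQ[of X]
    by (auto simp: Q2_eq_0_iff vanishes2_def dest: LIMSEQ_unique)
qed

lemma abs2_mult: "abs2 (x * y) = abs2 x * abs2 y"
proof (cases x rule: Q2_cases, cases y rule: Q2_cases)
  fix X Y assume *: "cauchy2 X" "x = Q2_of_seq X" "cauchy2 Y" "y = Q2_of_seq Y"
  have "(\<lambda>n. abs2_rat (X n * Y n)) \<longlonglongrightarrow> abs2 (x * y)"
    using abs2_LIMSEQ[OF cauchy2_mult[OF *(1,3)]] * by (simp add: Q2_mult)
  moreover have "(\<lambda>n. abs2_rat (X n * Y n)) \<longlonglongrightarrow> abs2 x * abs2 y"
    using tendsto_mult[OF abs2_LIMSEQ[OF *(1)] abs2_LIMSEQ[OF *(3)]] * by (simp add: abs2_rat_mult)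
  ultimately show ?thesis by (rule LIMSEQ_unique)
qed

lemma abs2_ultrametric: "abs2 (x + y) \<le> max (abs2 x) (abs2 y)"
proof (cases x rule: Q2_cases, cases y rule: Q2_cases)
  fix X Y assume *: "cauchy2 X" "x = Q2_of_seq X" "cauchy2 Y" "y = Q2_of_seq Y"
  have "(\<lambda>n. abs2_rat (X n + Y n)) \<longlonglongrightarrow> abs2 (x + y)"
    using abs2_LIMSEQ[OF cauchy2_add[OF *(1,3)]] * by (simp add: Q2_add)
  moreover have "(\<lambda>n. max (abs2_rat (X n)) (abs2_rat (Y n))) \<longlonglongrightarrow> max (abs2 x) (abs2 y)"
    using tendsto_max[OF abs2_LIMSEQ[OF *(1)] abs2_LIMSEQ[OF *(3)]] * by simp
  ultimately show ?thesis
    by (rule LIMSEQ_le) (auto intro: abs2_rat_ultrametric)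
qed

lemma abs2_one [simp]: "abs2 1 = 1"
  using abs2_mult[of 1 1] abs2_eq_0[of 1] by simp

lemma abs2_minus [simp]: "abs2 (- x) = abs2 x"
proof (cases x rule: Q2_cases)
  case (1 X)
  then have "(\<lambda>n. abs2_rat (X n)) \<longlonglongrightarrow> abs2 (- x)"
    using abs2_LIMSEQ[OF cauchy2_minus[of X]] by (simp add: Q2_minus)
  then show ?thesis using 1 abs2_LIMSEQ[of X] LIMSEQ_unique by blast
qed

instantiation q2 :: metric_space
begin

definition "dist x y = abs2 (x - y)" for x y :: q2

definition uniformity_q2 :: "(q2 \<times> q2) filter" where
  "uniformity_q2 = (INF e\<in>{0<..}. principal {(x, y). dist x y < e})"

definition open_q2 :: "q2 set \<Rightarrow> bool" where
  "open_q2 U \<longleftrightarrow> (\<forall>x\<in>U. \<forall>\<^sub>F (x', y) in uniformity. x' = x \<longrightarrow> y \<in> U)"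

instance
proof
  fix x y z :: q2
  show "dist x y = 0 \<longleftrightarrow> x = y" by (simp add: dist_q2_def)
  have "abs2 (x - y) \<le> max (abs2 (x - z)) (abs2 (z - y))"
    using abs2_ultrametric[of "x - z" "z - y"] by simp
  moreover have "abs2 (z - y) = abs2 (y - z)" using abs2_minus[of "y - z"] by simp
  ultimately show "dist x y \<le> dist x z + dist y z"
    using abs2_nonneg[of "x - z"] abs2_nonneg[of "y - z"] unfolding dist_q2_def by linarith
qed (simp_all add: uniformity_q2_def open_q2_def)

end

lemma of_nat_q2: "of_nat k = Q2_of_seq (\<lambda>n. of_nat k)"
  by (induction k) (simp_all add: zero_q2_def one_q2_def Q2_add)

instance q2 :: field_char_0
proof
  show "inj (of_nat :: nat \<Rightarrow> q2)"
    by (rule injI) (simp add: of_nat_q2 Q2_eq_iff)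
qed

lemma of_int_q2: "of_int k = Q2_of_seq (\<lambda>n. of_int k)"
  by (cases k) (simp_all del: of_nat_Suc add: of_nat_q2 Q2_minus)

lemma of_rat_q2: "of_rat r = Q2_of_seq (\<lambda>n. r)"
proof -
  obtain a b where r: "r = of_int a / of_int b" "b \<noteq> 0" by (rule rat_frac_cases)
  have "of_int b * Q2_of_seq (\<lambda>n. r) = of_int a"
    using r by (simp add: of_int_q2 Q2_mult)
  moreover have "of_int b * of_rat r = (of_int a :: q2)" using r(2) by (simp add: r(1) of_rat_divide)
  moreover have "(of_int b :: q2) \<noteq> 0" using r(2) by simp
  ultimately show ?thesis by (metis mult_left_cancel)
qed

lemma abs2_of_rat: "abs2 (of_rat r) = abs2_rat r"
proof -
  have "(\<lambda>n. abs2_rat r) \<longlonglongrightarrow> abs2 (of_rat r)"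
    using abs2_LIMSEQ[of "\<lambda>n. r"] by (simp add: of_rat_q2)
  then show ?thesis by (simp add: LIMSEQ_const_iff)
qed

lemma abs2_two [simp]: "abs2 2 = 1 / 2"
  using abs2_of_rat[of 2] by simp

lemma Q2_of_seq_LIMSEQ:
  assumes "cauchy2 X" shows "(\<lambda>n. of_rat (X n)) \<longlonglongrightarrow> Q2_of_seq X"
proof (rule metric_LIMSEQ_I)
  fix e :: real assume e: "0 < e"
  then obtain N where N: "\<And>m n. m \<ge> N \<Longrightarrow> n \<ge> N \<Longrightarrow> abs2_rat (X m - X n) < e / 2"
    using assms unfolding cauchy2_def by (metis half_gt_zero)
  have "dist (of_rat (X m)) (Q2_of_seq X) < e" if m: "m \<ge> N" for m
  proof -
    have c: "cauchy2 (\<lambda>n. X m - X n)"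
      using cauchy2_add[OF cauchy2_const cauchy2_minus[OF assms], of "X m"] by simp
    have "(\<lambda>n. abs2_rat (X m - X n)) \<longlonglongrightarrow> dist (of_rat (X m)) (Q2_of_seq X)"
      using abs2_LIMSEQ[OF c] assms by (simp add: dist_q2_def of_rat_q2 Q2_diff)
    then have "dist (of_rat (X m)) (Q2_of_seq X) \<le> e / 2"
      by (rule LIMSEQ_le_const2) (use N[OF m] in \<open>auto intro: less_imp_le\<close>)
    then show ?thesis using e by simp
  qed
  then show "\<exists>N. \<forall>n\<ge>N. dist (of_rat (X n)) (Q2_of_seq X) < e" by blast
qed

lemma closure_Rats_q2: "closure (\<rat> :: q2 set) = UNIV"
proof (rule UNIV_eq_I [symmetric])
  fix x :: q2
  obtain X where X: "cauchy2 X" "x = Q2_of_seq X" by (rule Q2_cases)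
  then show "x \<in> closure \<rat>"
    using Q2_of_seq_LIMSEQ[OF X(1)]
    by (auto simp: closure_sequential intro!: exI[of _ "\<lambda>n. of_rat (X n)"])
qed

instance q2 :: complete_space
proof
  fix Y :: "nat \<Rightarrow> q2" assume Y: "Cauchy Y"
  have "\<exists>r. dist (of_rat r) (Y n) < 1 / real (Suc n)" for n
  proof -
    have "Y n \<in> closure \<rat>" by (simp add: closure_Rats_q2)
    moreover have "1 / real (Suc n) > 0" by simp
    ultimately have "\<exists>y\<in>\<rat>. dist y (Y n) < 1 / real (Suc n)"
      by (simp only: closure_approachable)
    then show ?thesis by (auto simp: Rats_def)
  qed
  then have "\<exists>X. \<forall>n. dist (of_rat (X n)) (Y n) < 1 / real (Suc n)" by (intro choice) blast
  then obtain X where X: "\<And>n. dist (of_rat (X n)) (Y n) < 1 / real (Suc n)" by blast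
  have inv0: "(\<lambda>n. 1 / real (Suc n)) \<longlonglongrightarrow> 0" by (rule LIMSEQ_Suc[OF lim_1_over_n])
  have XY: "(\<lambda>n. dist (of_rat (X n)) (Y n)) \<longlonglongrightarrow> 0"
  proof (rule tendsto_sandwich[OF _ _ tendsto_const inv0])
    show "\<forall>\<^sub>F n in sequentially. dist (of_rat (X n)) (Y n) \<le> 1 / real (Suc n)"
      by (rule always_eventually) (rule allI, rule less_imp_le, rule X)
  qed simp
  have "cauchy2 X"
    unfolding cauchy2_def
  proof (intro allI impI)
    fix e :: real assume e: "0 < e"
    obtain N where N: "\<And>m n. m \<ge> N \<Longrightarrow> n \<ge> N \<Longrightarrow> dist (Y m) (Y n) < e / 3"
      using Y e metric_CauchyD[of Y "e / 3"] by auto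
    have "\<forall>\<^sub>F n in sequentially. dist (of_rat (X n)) (Y n) < e / 3"
      by (rule order_tendstoD(2)[OF XY]) (use e in simp)
    then obtain M where M: "\<And>n. n \<ge> M \<Longrightarrow> dist (of_rat (X n)) (Y n) < e / 3"
      by (auto simp: eventually_sequentially)
    have "abs2_rat (X m - X n) < e" if "m \<ge> max N M" "n \<ge> max N M" for m n
    proof -
      have "abs2_rat (X m - X n) = dist (of_rat (X m) :: q2) (of_rat (X n))"
        by (simp add: dist_q2_def abs2_of_rat flip: of_rat_diff)
      also have "\<dots> \<le> dist (of_rat (X m)) (Y m) + (dist (Y m) (Y n) + dist (of_rat (X n)) (Y n))"
        using dist_triangle[of "of_rat (X m) :: q2" "of_rat (X n)" "Y m"]
          dist_triangle2[of "Y m" "of_rat (X n)" "Y n"] by linarith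
      also have "\<dots> < e" using N[of m n] M[of m] M[of n] that by simp
      finally show ?thesis .
    qed
    then show "\<exists>N. \<forall>m\<ge>N. \<forall>n\<ge>N. abs2_rat (X m - X n) < e" by blast
  qed
  then have L: "(\<lambda>n. of_rat (X n)) \<longlonglongrightarrow> Q2_of_seq X" by (rule Q2_of_seq_LIMSEQ)
  have "(\<lambda>n. dist (of_rat (X n)) (Q2_of_seq X)) \<longlonglongrightarrow> 0" by (rule iffD1[OF tendsto_dist_iff L])
  from tendsto_add[OF XY this]
  have "(\<lambda>n. dist (of_rat (X n)) (Y n) + dist (of_rat (X n)) (Q2_of_seq X)) \<longlonglongrightarrow> 0" by simp
  then have "(\<lambda>n. dist (Y n) (Q2_of_seq X)) \<longlonglongrightarrow> 0"
  proof (rule tendsto_sandwich[OF _ _ tendsto_const, rotated 2])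
    show "\<forall>\<^sub>F n in sequentially. dist (Y n) (Q2_of_seq X)
        \<le> dist (of_rat (X n)) (Y n) + dist (of_rat (X n)) (Q2_of_seq X)"
      by (rule always_eventually) (rule allI, rule dist_triangle3)
  qed simp
  then have "Y \<longlonglongrightarrow> Q2_of_seq X" by (rule iffD2[OF tendsto_dist_iff])
  then show "convergent Y" by (auto simp: convergent_def)
qed


section \<open>The plane over the 2-adic numbers\<close>

text \<open>The topology of \<^typ>\<open>q2^2\<close> is the product topology, which is also the
  topology of the maximum norm below.\<close>

definition vnorm2 :: "q2^2 \<Rightarrow> real" where
  "vnorm2 x = max (abs2 (x $ 1)) (abs2 (x $ 2))"

definition Z2 :: "q2 set" where
  "Z2 = {x. abs2 x \<le> 1}"

definition Z2_plane :: "(q2^2) set" where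
  "Z2_plane = {x. x $ 1 \<in> Z2 \<and> x $ 2 \<in> Z2}"

text \<open>The representatives \<open>\<Sum>m=\<beta>..-1. d m * 2^m\<close> of \<open>\<rat>\<^sub>2/\<int>\<^sub>2\<close>; for \<open>\<beta> \<ge> 0\<close> the
  sum is empty and the representative is 0.\<close>

definition frac_reps :: "q2 set" where
  "frac_reps = {x. \<exists>(\<beta>::int) (d::int \<Rightarrow> nat). (\<forall>m. d m \<in> {0, 1}) \<and>
                   x = (\<Sum>m\<in>{\<beta>..-1}. of_nat (d m) * 2 powi m)}"

definition frac_reps_plane :: "(q2^2) set" where
  "frac_reps_plane = {n. n $ 1 \<in> frac_reps \<and> n $ 2 \<in> frac_reps}"

definition mat_powi :: "'a::field^'n^'n \<Rightarrow> int \<Rightarrow> 'a^'n^'n" where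
  "mat_powi A j = (if 0 \<le> j then (((**) A) ^^ nat j) (mat 1)
                   else (((**) (matrix_inv A)) ^^ nat (- j)) (mat 1))"


section \<open>Haar measure and orthonormal bases\<close>

text \<open>No regularity clause is needed for \<^typ>\<open>q2^2\<close>: on a second countable locally
  compact group, finiteness on compact sets already implies regularity.\<close>

definition haar_measure :: "'a::{topological_space, ab_group_add} measure \<Rightarrow> bool" where
  "haar_measure M \<longleftrightarrow>
     sets M = sets borel \<and>
     (\<forall>A\<in>sets M. \<forall>a. emeasure M ((+) a ` A) = emeasure M A) \<and>
     (\<forall>K. compact K \<longrightarrow> emeasure M K < \<infinity>) \<and>
     emeasure M UNIV \<noteq> 0"

text \<open>Elements of the complex space \<open>L\<^sup>2\<close> are represented by functions; all notions
  below are invariant under changing a function on a null set. A basis is an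
  orthonormal family, indexed without repetition, whose linear span is dense.\<close>

definition L2 :: "'a measure \<Rightarrow> ('a \<Rightarrow> complex) set" where
  "L2 M = {f \<in> borel_measurable M. integrable M (\<lambda>x. (cmod (f x))\<^sup>2)}"

definition L2_inner :: "'a measure \<Rightarrow> ('a \<Rightarrow> complex) \<Rightarrow> ('a \<Rightarrow> complex) \<Rightarrow> complex" where
  "L2_inner M f g = (\<integral>x. f x * cnj (g x) \<partial>M)"

definition L2_norm :: "'a measure \<Rightarrow> ('a \<Rightarrow> complex) \<Rightarrow> real" where
  "L2_norm M f = sqrt (\<integral>x. (cmod (f x))\<^sup>2 \<partial>M)"

definition L2_orthonormal_basis :: "'a measure \<Rightarrow> 'i set \<Rightarrow> ('i \<Rightarrow> 'a \<Rightarrow> complex) \<Rightarrow> bool" where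
  "L2_orthonormal_basis M I e \<longleftrightarrow>
     (\<forall>i\<in>I. e i \<in> L2 M) \<and>
     (\<forall>i\<in>I. \<forall>k\<in>I. L2_inner M (e i) (e k) = (if i = k then 1 else 0)) \<and>
     (\<forall>f\<in>L2 M. \<forall>\<epsilon>>0. \<exists>F c. finite F \<and> F \<subseteq> I \<and>
        L2_norm M (\<lambda>x. f x - (\<Sum>i\<in>F. c i * e i x)) < \<epsilon>)"


section \<open>The Haar wavelet\<close>

definition Omega :: "real \<Rightarrow> real" where
  "Omega = indicator {0..1}"

definition S :: "q2^2^2" where
  "S = vector [vector [0, 1], vector [2, 0]]"

definition theta :: "q2^2 \<Rightarrow> real" where
  "theta x = Omega (vnorm2 (matrix_inv S *v x))
           - Omega (vnorm2 (matrix_inv S *v x - vector [1/2, 0]))"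

definition theta_jn :: "int \<Rightarrow> q2^2 \<Rightarrow> q2^2 \<Rightarrow> real" where
  "theta_jn j n x = 2 powr (real_of_int j / 2) * theta (mat_powi S (- j) *v x - n)"

lemma matrix_inv_S: "matrix_inv S = vector [vector [0, 1/2], vector [1, 0]]"
proof -
  define T :: "q2^2^2" where "T = vector [vector [0, 1/2], vector [1, 0]]"
  have ST: "S ** T = mat 1" and TS: "T ** S = mat 1"
    by (simp_all add: S_def T_def vec_eq_iff forall_2 matrix_matrix_mult_def sum_2 mat_def)
  have "matrix_inv S = T"
    unfolding matrix_inv_def
  proof (rule some_equality)
    fix U assume "S ** U = mat 1 \<and> U ** S = mat 1"
    then have "U ** (S ** T) = T" by (simp add: matrix_mul_assoc)
    then show "U = T" by (simp add: ST)
  qed (simp add: ST TS)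
  then show ?thesis by (simp add: T_def)
qed

end

theory Submission
  imports Defs
begin

text \<open>The reason is that of the real Haar basis, with nested cosets in place of dyadic intervals. Put
  \<open>L\<^sub>j = S\<^sup>j \<int>\<^sub>2\<^sup>2\<close>. Since \<open>S (x\<^sub>1, x\<^sub>2) = (x\<^sub>2, 2 x\<^sub>1)\<close>, the subgroup \<open>L\<^sub>j\<^sub>+\<^sub>1\<close> has index 2 in \<open>L\<^sub>j\<close>, and
  the other coset is that of \<open>S\<^sup>j (0, 1)\<close>. A cell of level \<open>j\<close> is a coset \<open>a + L\<^sub>j\<close>: each cell is the
  disjoint union of two cells of the next level (\<open>cell_split\<close>), and the cells of level \<open>j\<close> are indexed
  without repetition by the representatives \<open>n\<close> of \<open>\<rat>\<^sub>2\<^sup>2/\<int>\<^sub>2\<^sup>2\<close>, the cell of \<open>n\<close> being \<open>S\<^sup>j n + L\<^sub>j\<close>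
  (\<open>ex_frac_rep_cell\<close>, \<open>frac_rep_cell_unique\<close>). Translation invariance gives both halves the same
  measure, so \<open>\<mu> (\<int>\<^sub>2\<^sup>2) = 1\<close> forces the measure of a cell of level \<open>j\<close> to be \<open>2\<^sup>-\<^sup>j\<close> (\<open>emeasure_cell\<close>).

  In these terms \<open>\<theta>\<^sub>j\<^sub>n\<close> is \<open>2\<^sup>j\<^sup>/\<^sup>2\<close> times the difference of the indicators of the two halves of the
  cell of \<open>n\<close> (\<open>theta_jn_eq_wavelet\<close>). It has norm one. Two of these functions of the same level have
  disjoint supports; of two with different levels, the coarser one is constant on the support
  of the finer one, which has integral zero.

  For completeness, the indicator of a half of a cell is \<open>1/2\<close> the indicator of the cell plus a multiple
  of a wavelet. Going up \<open>K\<close> levels, the indicator of a cell of level \<open>j\<close> is a finite combination of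
  wavelets plus \<open>2\<^sup>-\<^sup>K\<close> times the indicator of its ancestor, and that remainder has squared norm
  \<open>2\<^sup>-\<^sup>2\<^sup>K 2\<^sup>K\<^sup>-\<^sup>j\<close>, which tends to zero (\<open>indicator_cell_in_span\<close>). So the closed span contains the
  indicators of all cells. These form a countable intersection-stable generator of the Borel sets
  (\<open>borel_plane_eq_sigma_cells\<close>), and a Dynkin argument followed by approximation by simple functions
  gives all of \<open>L\<^sup>2\<close> (\<open>indicator_from_generator\<close>, \<open>eq_L2_if_indicators\<close>).\<close>

section \<open>Residues and fractional parts of 2-adic numbers\<close>

lemma abs2_diff_commute: "abs2 (x - y) = abs2 (y - x)"
  using abs2_minus[of "x - y"] by simp

lemma abs2_diff_ultrametric: "abs2 (x - y) \<le> max (abs2 x) (abs2 y)"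
  using abs2_ultrametric[of x "- y"] by simp

lemma abs2_divide: "abs2 (x / y) = abs2 x / abs2 y"
proof (cases "y = 0")
  case False
  then have "abs2 (x / y) * abs2 y = abs2 x"
    by (simp flip: abs2_mult)
  then show ?thesis
    using False by (simp add: field_simps)
qed (simp add: abs2_eq_0[THEN iffD2])

lemma abs2_power_two: "abs2 (2 ^ k) = (1 / 2) ^ k"
  by (induction k) (simp_all add: abs2_mult)

lemma powi_minus_Suc: "x powi (- int (Suc k)) = 1 / (x :: 'a :: field) ^ Suc k"
  by (simp only: power_int_minus power_int_of_nat inverse_eq_divide)

lemma Z2_add: "x \<in> Z2 \<Longrightarrow> y \<in> Z2 \<Longrightarrow> x + y \<in> Z2"
  using abs2_ultrametric[of x y] by (simp add: Z2_def)

lemma Z2_diff: "x \<in> Z2 \<Longrightarrow> y \<in> Z2 \<Longrightarrow> x - y \<in> Z2"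
  using abs2_diff_ultrametric[of x y] by (simp add: Z2_def)

lemma half_in_Z2_iff: "x / 2 \<in> Z2 \<longleftrightarrow> abs2 x \<le> 1 / 2"
  by (simp add: Z2_def abs2_divide)

lemma half_notin_Z2: "1 / 2 \<notin> Z2"
  by (simp add: half_in_Z2_iff)

text \<open>A 2-integral fraction in lowest terms has an odd denominator, so its residue modulo 2 is the parity
  of the numerator.\<close>

lemma abs2_rat_residue:
  assumes "abs2_rat r \<le> 1"
  shows "abs2_rat r \<le> 1 / 2 \<or> abs2_rat (r - 1) \<le> 1 / 2"
proof -
  obtain p q where pq: "quotient_of r = (p, q)" by force
  have q: "q > 0" using quotient_of_denom_pos[OF pq] .
  have r: "r = of_int p / of_int q" using quotient_of_div[OF pq] .
  have co: "coprime p q" using quotient_of_coprime[OF pq] .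
  have abs_even: "abs2_rat (of_int k / of_int q) \<le> 1 / 2" if "even k" "odd q" for k
  proof -
    obtain l where l: "k = 2 * l" using \<open>even k\<close> by blast
    have "abs2_rat (of_int q) = 1"
      using abs2_rat_divide[of q 1] \<open>odd q\<close> q by (simp add: not_dvd_imp_multiplicity_0)
    then show ?thesis
      using abs2_rat_of_int_le[of l] by (simp add: l abs2_rat_divide_eq abs2_rat_mult)
  qed
  have "odd q"
  proof
    assume "even q"
    then have "odd p" using coprime_common_divisor[OF co, of 2] by auto
    then have "abs2_rat r = 2 powi int (multiplicity 2 q)"
      using q r abs2_rat_divide[of p q] by (auto simp: not_dvd_imp_multiplicity_0)
    moreover have "multiplicity 2 q > 0"
      using \<open>even q\<close> q by (simp add: multiplicity_gt_zero_iff)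
    then have "1 < (2 :: real) ^ multiplicity 2 q" by (rule one_less_power[rotated]) simp
    ultimately show False using assms by simp
  qed
  show ?thesis
  proof (cases "even p")
    case True
    then show ?thesis using abs_even[of p] \<open>odd q\<close> r by simp
  next
    case False
    moreover have "r - 1 = of_int (p - q) / of_int q" using q r by (simp add: field_simps)
    ultimately show ?thesis using abs_even[of "p - q"] \<open>odd q\<close> by simp
  qed
qed

text \<open>Density of the rationals carries over the rational case: a number within distance less than \<open>1/2\<close>
  has the same residue.\<close>

lemma Z2_residue:
  assumes "x \<in> Z2"
  shows "x / 2 \<in> Z2 \<or> (x - 1) / 2 \<in> Z2"
proof -
  have "x \<in> closure \<rat>" by (simp add: closure_Rats_q2)
  then have "\<exists>y\<in>\<rat>. dist y x < 1 / 2" by (simp only: closure_approachable)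
  then obtain r where r: "abs2 (of_rat r - x) < 1 / 2" by (auto simp: Rats_def dist_q2_def)
  have "abs2 (of_rat r) \<le> 1"
    using abs2_ultrametric[of "of_rat r - x" x] r assms by (simp add: Z2_def)
  then consider "abs2 (of_rat r) \<le> 1 / 2" | "abs2 (of_rat r - 1) \<le> 1 / 2"
    using abs2_rat_residue[of r] abs2_of_rat[of r] abs2_of_rat[of "r - 1"]
    by (auto simp: of_rat_diff)
  then show ?thesis
  proof cases
    case 1
    then have "abs2 x \<le> 1 / 2"
      using abs2_diff_ultrametric[of "of_rat r" "of_rat r - x"] r by simp
    then show ?thesis by (simp only: half_in_Z2_iff) simp
  next
    case 2
    then have "abs2 (x - 1) \<le> 1 / 2"
      using abs2_diff_ultrametric[of "of_rat r - 1" "of_rat r - x"] r by simp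
    then show ?thesis by (simp only: half_in_Z2_iff) simp
  qed
qed

text \<open>The digits are found from the most negative exponent upwards: removing one digit halves the bound
  on the absolute value.\<close>

lemma frac_reps_approx_bounded:
  "abs2 y \<le> 2 ^ k \<Longrightarrow>
    \<exists>d::int \<Rightarrow> nat. (\<forall>m. d m \<in> {0, 1}) \<and>
      y - (\<Sum>m\<in>{- int k..-1}. of_nat (d m) * 2 powi m) \<in> Z2"
proof (induction k arbitrary: y)
  case 0
  then show ?case by (intro exI[of _ "\<lambda>_. 0"]) (simp add: Z2_def)
next
  case (Suc k)
  \<comment> \<open>The residue of this unit-scale multiple is the digit at \<open>2\<^sup>-\<^sup>(\<^sup>k\<^sup>+\<^sup>1\<^sup>)\<close>.\<close>
  define z where "z = y * 2 ^ Suc k"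
  have y: "y = z / 2 ^ Suc k" by (simp add: z_def)
  have "abs2 z = abs2 y * (1 / 2) ^ Suc k"
    unfolding z_def by (simp only: abs2_mult abs2_power_two)
  also have "\<dots> \<le> 2 ^ Suc k * (1 / 2) ^ Suc k"
    using Suc.prems by (intro mult_right_mono) simp_all
  also have "\<dots> = 1" by (simp add: field_simps)
  finally have "z \<in> Z2" by (simp add: Z2_def)
  then obtain b :: nat where b: "b \<in> {0, 1}" "(z - of_nat b) / 2 \<in> Z2"
    using Z2_residue[of z] by force
  define y' where "y' = y - of_nat b * 2 powi (- int (Suc k))"
  have "y' = ((z - of_nat b) / 2) / 2 ^ k"
    by (simp only: y'_def y powi_minus_Suc) (simp add: field_simps)
  then have "abs2 y' = abs2 ((z - of_nat b) / 2) * 2 ^ k"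
    by (simp only: abs2_divide[of _ "2 ^ k"] abs2_power_two) (simp add: power_one_over)
  also have "\<dots> \<le> 2 ^ k" using b by (simp add: Z2_def)
  finally obtain d :: "int \<Rightarrow> nat" where d: "\<And>m. d m \<in> {0, 1}"
      "y' - (\<Sum>m\<in>{- int k..-1}. of_nat (d m) * 2 powi m) \<in> Z2"
    using Suc.IH by blast
  have "{- int (Suc k)..-1} = insert (- int (Suc k)) {- int k..-1}" by auto
  then have "(\<Sum>m\<in>{- int (Suc k)..-1}. of_nat ((d(- int (Suc k) := b)) m) * 2 powi m)
      = (of_nat b * 2 powi (- int (Suc k)) :: q2) + (\<Sum>m\<in>{- int k..-1}. of_nat (d m) * 2 powi m)"
    by (auto intro!: sum.cong)
  then have "y - (\<Sum>m\<in>{- int (Suc k)..-1}. of_nat ((d(- int (Suc k) := b)) m) * 2 powi m) \<in> Z2"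
    using d(2) by (simp add: y'_def algebra_simps)
  then show ?case using d(1) b(1) by (intro exI[of _ "d(- int (Suc k) := b)"]) auto
qed

lemma ex_frac_rep: "\<exists>n\<in>frac_reps. y - n \<in> Z2"
proof -
  obtain k where "abs2 y \<le> 2 ^ k"
    using real_arch_pow[of 2 "abs2 y"] by (auto intro: less_imp_le)
  from frac_reps_approx_bounded[OF this] show ?thesis
    unfolding frac_reps_def by blast
qed

lemma frac_reps_imp_dyadic_fraction:
  assumes "x \<in> frac_reps"
  shows "\<exists>N k. N < 2 ^ k \<and> x = of_nat N / 2 ^ k"
proof -
  obtain \<beta> :: int and d :: "int \<Rightarrow> nat" where d: "\<And>m. d m \<in> {0, 1}"
    and x: "x = (\<Sum>m\<in>{\<beta>..-1}. of_nat (d m) * 2 powi m)"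
    using assms unfolding frac_reps_def by blast
  have "\<exists>N < 2 ^ k. (\<Sum>m\<in>{- int k..-1}. of_nat (d m) * 2 powi m) = (of_nat N / 2 ^ k :: q2)" for k
  proof (induction k)
    case 0
    then show ?case by simp
  next
    case (Suc k)
    then obtain N where N: "N < 2 ^ k"
        "(\<Sum>m\<in>{- int k..-1}. of_nat (d m) * 2 powi m) = (of_nat N / 2 ^ k :: q2)"
      by blast
    define b where "b = d (- int (Suc k))"
    have "{- int (Suc k)..-1} = insert (- int (Suc k)) {- int k..-1}" by auto
    then have "(\<Sum>m\<in>{- int (Suc k)..-1}. of_nat (d m) * 2 powi m)
        = of_nat b * 2 powi (- int (Suc k)) + (of_nat N / 2 ^ k :: q2)"
      using N(2) by (simp add: b_def)
    also have "\<dots> = of_nat (b + 2 * N) / 2 ^ Suc k"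
      by (simp only: powi_minus_Suc) (simp add: field_simps)
    finally have "(\<Sum>m\<in>{- int (Suc k)..-1}. of_nat (d m) * 2 powi m)
        = (of_nat (b + 2 * N) / 2 ^ Suc k :: q2)" .
    moreover have "b + 2 * N < 2 ^ Suc k"
      using d[of "- int (Suc k)"] N(1) by (auto simp: b_def)
    ultimately show ?case by blast
  qed
  from this[of "nat (- \<beta>)"] show ?thesis
    unfolding x by (cases "\<beta> \<le> 0") (force intro: exI[of _ 0])+
qed

lemma of_int_abs2_small_imp_dvd:
  assumes "abs2 (of_int M) \<le> (1 / 2) ^ k"
  shows "2 ^ k dvd M"
proof (cases "M = 0")
  case False
  have "abs2 (of_int M) = 2 powi (- int (multiplicity 2 M))"
    using abs2_of_rat[of "of_int M"] abs2_rat_divide[of M 1] False by simp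
  also have "\<dots> = (1 / 2) ^ multiplicity 2 M"
    by (simp add: power_int_minus power_one_over field_simps)
  finally have "(1 / 2 :: real) ^ multiplicity 2 M \<le> (1 / 2) ^ k"
    using assms by simp
  then have "k \<le> multiplicity 2 M"
    by (subst (asm) power_decreasing_iff) auto
  then show ?thesis by (rule multiplicity_dvd')
qed simp

text \<open>Over a common denominator \<open>2\<^sup>k\<^sup>+\<^sup>l\<close>, the difference has a numerator of absolute value less than
  \<open>2\<^sup>k\<^sup>+\<^sup>l\<close>; if the difference is 2-integral, this numerator is divisible by \<open>2\<^sup>k\<^sup>+\<^sup>l\<close>, hence zero.\<close>

lemma frac_rep_unique:
  assumes "m \<in> frac_reps" "n \<in> frac_reps" "m - n \<in> Z2"
  shows "m = n"
proof -
  obtain N k where m: "N < 2 ^ k" "m = of_nat N / 2 ^ k"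
    using frac_reps_imp_dyadic_fraction[OF assms(1)] by blast
  obtain N' l where n: "N' < 2 ^ l" "n = of_nat N' / 2 ^ l"
    using frac_reps_imp_dyadic_fraction[OF assms(2)] by blast
  define M where "M = int N * 2 ^ l - int N' * 2 ^ k"
  have diff: "of_int M = (m - n) * 2 ^ (k + l)"
    by (simp add: m n M_def field_simps power_add)
  have "abs2 (of_int M) = abs2 (m - n) * (1 / 2) ^ (k + l)"
    unfolding diff by (simp only: abs2_mult abs2_power_two)
  also have "\<dots> \<le> 1 * (1 / 2) ^ (k + l)"
    using assms(3) by (intro mult_right_mono) (simp_all add: Z2_def)
  finally have "2 ^ (k + l) dvd M"
    by (intro of_int_abs2_small_imp_dvd) simp
  moreover have "\<bar>M\<bar> < 2 ^ (k + l)"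
  proof -
    have "int N < 2 ^ k" "int N' < 2 ^ l"
      using m(1) n(1) by simp_all
    then have "int N * 2 ^ l < 2 ^ (k + l)" "int N' * 2 ^ k < 2 ^ (k + l)"
      by (simp_all add: power_add mult.commute[of "2 ^ k"])
    moreover have "int N * 2 ^ l \<ge> 0" "int N' * 2 ^ k \<ge> 0" by simp_all
    ultimately show ?thesis unfolding M_def by linarith
  qed
  ultimately have "M = 0"
    using dvd_imp_le_int[of M "2 ^ (k + l)"] by fastforce
  then show ?thesis using diff by simp
qed

section \<open>Powers of the dilation\<close>

lemma S_inverse: "S ** matrix_inv S = mat 1" "matrix_inv S ** S = mat 1"
  unfolding matrix_inv_S unfolding S_def
  by (simp_all add: vec_eq_iff forall_2 matrix_matrix_mult_def sum_2 mat_def)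

lemma mat_powi_add_one:
  fixes A :: "'a::field^'n^'n"
  assumes "A ** matrix_inv A = mat 1"
  shows "mat_powi A (j + 1) = A ** mat_powi A j"
proof (cases "j \<ge> 0")
  case True
  then have "nat (j + 1) = Suc (nat j)" by simp
  then show ?thesis using True by (simp add: mat_powi_def)
next
  case False
  define k where "k = nat (- j - 1)"
  have j: "j + 1 = - int k" "j = - int (Suc k)" using False by (simp_all add: k_def)
  have neg: "mat_powi A (- int l) = ((**) (matrix_inv A) ^^ l) (mat 1)" for l
    by (cases "l = 0") (simp_all add: mat_powi_def)
  have "mat_powi A (j + 1) = ((**) (matrix_inv A) ^^ k) (mat 1)"
    unfolding j(1) by (rule neg)
  moreover have "mat_powi A j = matrix_inv A ** ((**) (matrix_inv A) ^^ k) (mat 1)"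
    unfolding j(2) neg by simp
  ultimately show ?thesis by (simp add: matrix_mul_assoc assms)
qed

definition S_inv_pow :: "int \<Rightarrow> q2^2 \<Rightarrow> q2^2" where
  "S_inv_pow j x = mat_powi S (- j) *v x"

lemma S_inv_pow_add_one: "S_inv_pow (j + 1) x = matrix_inv S *v S_inv_pow j x"
proof -
  have "mat_powi S (- (j + 1) + 1) = S ** mat_powi S (- (j + 1))"
    by (rule mat_powi_add_one[OF S_inverse(1)])
  then have "mat_powi S (- j) = S ** mat_powi S (- (j + 1))" by simp
  then have "matrix_inv S ** mat_powi S (- j) = mat_powi S (- (j + 1))"
    by (simp add: matrix_mul_assoc S_inverse)
  then show ?thesis
    by (simp add: S_inv_pow_def matrix_vector_mul_assoc)
qed

lemma S_inv_pow_0: "S_inv_pow 0 x = x"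
  by (simp add: S_inv_pow_def mat_powi_def)

lemma S_inv_pow_surj: "\<exists>x. S_inv_pow j x = y"
proof (induction j arbitrary: y rule: int_induct[of _ 0])
  case base
  then show ?case by (simp add: S_inv_pow_0)
next
  case (step1 j)
  obtain x where "S_inv_pow j x = S *v y" using step1.IH by blast
  then show ?case
    by (intro exI[of _ x])
       (simp add: S_inv_pow_add_one matrix_vector_mul_assoc S_inverse)
next
  case (step2 j)
  obtain x where "S_inv_pow j x = matrix_inv S *v y" using step2.IH by blast
  then have "matrix_inv S *v S_inv_pow (j - 1) x = matrix_inv S *v y"
    using S_inv_pow_add_one[of "j - 1" x] by simp
  then have "S *v (matrix_inv S *v S_inv_pow (j - 1) x) = S *v (matrix_inv S *v y)" by simp
  then show ?case
    by (intro exI[of _ x]) (simp add: matrix_vector_mul_assoc S_inverse)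
qed

lemma S_inv_pow_diff: "S_inv_pow j (x - y) = S_inv_pow j x - S_inv_pow j y"
  by (simp add: S_inv_pow_def matrix_vector_mult_diff_distrib)

text \<open>The square of \<open>S\<close> is twice the identity, so even powers are plain dilations. This relates
  cells to the metric.\<close>

lemma S_inv_pow_even: "S_inv_pow (2 * int k) x $ i = x $ i / 2 ^ k"
proof (induction k arbitrary: i)
  case 0
  then show ?case by (simp add: S_inv_pow_0)
next
  case (Suc k)
  have "2 * int (Suc k) = 2 * int k + 1 + 1" by simp
  then have "S_inv_pow (2 * int (Suc k)) x = matrix_inv S *v (matrix_inv S *v S_inv_pow (2 * int k) x)"
    by (simp only: S_inv_pow_add_one)
  then have "S_inv_pow (2 * int (Suc k)) x $ i = S_inv_pow (2 * int k) x $ i / 2"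
    using exhaust_2[of i]
    by (auto simp: matrix_inv_S matrix_vector_mult_def sum_2)
  then show ?case by (simp add: Suc)
qed

section \<open>The tree of cells\<close>

lemma Z2_plane_add: "x \<in> Z2_plane \<Longrightarrow> y \<in> Z2_plane \<Longrightarrow> x + y \<in> Z2_plane"
  by (simp add: Z2_plane_def Z2_add)

lemma Z2_plane_diff: "x \<in> Z2_plane \<Longrightarrow> y \<in> Z2_plane \<Longrightarrow> x - y \<in> Z2_plane"
  by (simp add: Z2_plane_def Z2_diff)

lemma S_inv_in_Z2_plane_iff: "matrix_inv S *v x \<in> Z2_plane \<longleftrightarrow> x $ 1 \<in> Z2 \<and> x $ 2 / 2 \<in> Z2"
  by (auto simp: Z2_plane_def matrix_inv_S matrix_vector_mult_def sum_2)

lemma Z2_imp_half: "x / 2 \<in> Z2 \<Longrightarrow> x \<in> Z2"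
  using Z2_add[of "x / 2" "x / 2"] by simp

text \<open>The product \<open>S\<^sup>j v\<close>, given by what is used about it: \<open>S\<^sup>-\<^sup>j\<close> takes it back to \<open>v\<close>.\<close>

definition S_pow :: "int \<Rightarrow> q2^2 \<Rightarrow> q2^2" where
  "S_pow j v = (SOME x. S_inv_pow j x = v)"

lemma S_inv_pow_S_pow: "S_inv_pow j (S_pow j v) = v"
  unfolding S_pow_def by (rule someI_ex) (rule S_inv_pow_surj)

text \<open>A representative of the nontrivial coset of \<open>S\<^sup>j\<^sup>+\<^sup>1 \<int>\<^sub>2\<^sup>2\<close> in \<open>S\<^sup>j \<int>\<^sub>2\<^sup>2\<close>.\<close>

definition shift :: "int \<Rightarrow> q2^2" where
  "shift j = S_pow j (axis 2 1)"

lemma S_inv_pow_shift: "S_inv_pow j (shift j) = axis 2 1"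
  by (simp add: shift_def S_inv_pow_S_pow)

text \<open>The coset \<open>a + S\<^sup>j \<int>\<^sub>2\<^sup>2\<close>.\<close>

definition cell :: "int \<Rightarrow> q2^2 \<Rightarrow> (q2^2) set" where
  "cell j a = {x. S_inv_pow j (x - a) \<in> Z2_plane}"

lemma cell_self: "a \<in> cell j a"
  using S_inv_pow_diff[of j a a] by (simp add: cell_def Z2_plane_def Z2_def abs2_eq_0[THEN iffD2])

lemma cell_eq: 
  assumes "b \<in> cell j a" shows "cell j b = cell j a"
proof -
  have "x \<in> cell j b \<longleftrightarrow> x \<in> cell j a" for x
    using Z2_plane_add[of "S_inv_pow j (x - b)" "S_inv_pow j (b - a)"]
      Z2_plane_diff[of "S_inv_pow j (x - a)" "S_inv_pow j (b - a)"] assms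
    by (auto simp: cell_def S_inv_pow_diff)
  then show ?thesis by blast
qed

lemma cell_commute: "b \<in> cell j a \<longleftrightarrow> a \<in> cell j b"
  using cell_eq[of b j a] cell_eq[of a j b] cell_self[of a j] cell_self[of b j] by auto

lemma cell_disjoint: "b \<notin> cell j a \<Longrightarrow> cell j b \<inter> cell j a = {}"
proof (rule ccontr)
  assume b: "b \<notin> cell j a" and "cell j b \<inter> cell j a \<noteq> {}"
  then obtain x where "x \<in> cell j b" "x \<in> cell j a" by blast
  then have "cell j b = cell j a" using cell_eq[of x j b] cell_eq[of x j a] by simp
  then show False using b cell_self[of b j] by simp
qed

lemma cell_translate: "(+) c ` cell j a = cell j (a + c)"
proof -
  have "x \<in> (+) c ` cell j a \<longleftrightarrow> x - c \<in> cell j a" for x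
    by (force simp: image_iff)
  then show ?thesis by (auto simp: cell_def algebra_simps)
qed

lemma cell_zero_zero: "cell 0 0 = Z2_plane"
  by (simp add: cell_def S_inv_pow_0)

lemma cell_Suc_iff:
  "x \<in> cell (j + 1) a \<longleftrightarrow> S_inv_pow j (x - a) $ 1 \<in> Z2 \<and> S_inv_pow j (x - a) $ 2 / 2 \<in> Z2"
  by (simp add: cell_def S_inv_pow_add_one S_inv_in_Z2_plane_iff)

lemma cell_Suc_subset: "cell (j + 1) a \<subseteq> cell j a"
  using Z2_imp_half by (auto simp: cell_Suc_iff) (auto simp: cell_def Z2_plane_def)

lemma cell_antimono:
  assumes "j \<le> k" shows "cell k a \<subseteq> cell j a"
  using assms
proof (induction k rule: int_ge_induct)
  case (step k)
  then show ?case using cell_Suc_subset[of k a] by blast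
qed simp

lemma cell_Suc_shift_iff:
  "x \<in> cell (j + 1) (a + shift j) \<longleftrightarrow>
     S_inv_pow j (x - a) $ 1 \<in> Z2 \<and> (S_inv_pow j (x - a) $ 2 - 1) / 2 \<in> Z2"
proof -
  have "S_inv_pow j (x - (a + shift j)) = S_inv_pow j (x - a) - axis 2 1"
    by (simp add: S_inv_pow_diff[symmetric] S_inv_pow_shift[of j, symmetric] algebra_simps)
  then show ?thesis by (simp add: cell_Suc_iff axis_def)
qed

text \<open>In the coordinates \<open>y = S\<^sup>-\<^sup>j (x - a)\<close> the two halves are told apart by the residue of
  \<open>y\<^sub>2\<close> modulo 2.\<close>

lemma cell_split:
  "cell j a = cell (j + 1) a \<union> cell (j + 1) (a + shift j)"
  "cell (j + 1) a \<inter> cell (j + 1) (a + shift j) = {}"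
proof -
  have "x \<in> cell j a \<longleftrightarrow> x \<in> cell (j + 1) a \<or> x \<in> cell (j + 1) (a + shift j)" for x
  proof -
    define y where "y = S_inv_pow j (x - a)"
    have "y $ 2 \<in> Z2 \<longleftrightarrow> y $ 2 / 2 \<in> Z2 \<or> (y $ 2 - 1) / 2 \<in> Z2"
      using Z2_residue[of "y $ 2"] Z2_imp_half[of "y $ 2"] Z2_imp_half[of "y $ 2 - 1"]
        Z2_add[of "y $ 2 - 1" 1] by (auto simp: Z2_def)
    then show ?thesis
      unfolding cell_Suc_shift_iff unfolding cell_Suc_iff y_def[symmetric]
      by (auto simp: cell_def y_def[symmetric] Z2_plane_def)
  qed
  then show "cell j a = cell (j + 1) a \<union> cell (j + 1) (a + shift j)" by blast
  have "\<not> (z / 2 \<in> Z2 \<and> (z - 1) / 2 \<in> Z2)" for z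
    using Z2_diff[of "z / 2" "(z - 1) / 2"] half_notin_Z2 by (auto simp: diff_divide_distrib)
  then show "cell (j + 1) a \<inter> cell (j + 1) (a + shift j) = {}"
    by (auto simp: cell_Suc_shift_iff) (auto simp: cell_Suc_iff)
qed

text \<open>This tree structure makes the cells intersection-stable.\<close>

lemma cell_subset_or_disjoint:
  assumes "j \<le> k"
  shows "cell k b \<subseteq> cell j a \<or> cell k b \<inter> cell j a = {}"
proof (cases "b \<in> cell j a")
  case True
  then show ?thesis using cell_antimono[OF assms, of b] cell_eq by blast
next
  case False
  then show ?thesis using cell_antimono[OF assms, of b] cell_disjoint by blast
qed

lemma small_cell_subset_ball:
  assumes "e > 0" shows "\<exists>j. cell j a \<subseteq> ball a e"
proof -
  obtain k where k: "(1 / 2) ^ k < e / 2"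
    using real_arch_pow_inv[of "e / 2" "1 / 2"] assms by auto
  have "dist a x < e" if "x \<in> cell (2 * int k) a" for x
  proof -
    have c: "dist (a $ i) (x $ i) \<le> (1 / 2) ^ k" for i
    proof -
      have "(x $ i - a $ i) / 2 ^ k \<in> Z2"
        using that exhaust_2[of i] by (auto simp: cell_def Z2_plane_def S_inv_pow_even)
      then have "abs2 (x $ i - a $ i) \<le> (1 / 2) ^ k"
        by (simp add: Z2_def abs2_divide abs2_power_two power_one_over field_simps)
      then show ?thesis by (simp add: dist_q2_def abs2_diff_commute)
    qed
    have "dist a x \<le> (\<Sum>i\<in>UNIV. dist (a $ i) (x $ i))"
      unfolding dist_vec_def by (rule L2_set_le_sum) simp
    also have "\<dots> < e" using c[of 1] c[of 2] k by (simp add: sum_2)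
    finally show ?thesis .
  qed
  then show ?thesis by (intro exI[of _ "2 * int k"]) (auto simp: mem_ball)
qed

text \<open>A cell of high even level is a ball for the maximum norm, and it is contained in every cell of
  lower level that it meets.\<close>

lemma open_cell: "open (cell j a)"
  unfolding open_dist
proof (intro ballI)
  fix x assume x: "x \<in> cell j a"
  define k where "k = nat \<bar>j\<bar>"
  have k: "j \<le> 2 * int k" by (simp add: k_def)
  have "y \<in> cell j a" if "dist y x < (1 / 2) ^ k" for y
  proof -
    have "(y $ i - x $ i) / 2 ^ k \<in> Z2" for i
    proof -
      have "abs2 (y $ i - x $ i) \<le> (1 / 2) ^ k"
        using dist_vec_nth_le[of y i x] that by (simp add: dist_q2_def)
      then show ?thesis by (simp add: Z2_def abs2_divide abs2_power_two power_one_over field_simps)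
    qed
    then have "y \<in> cell (2 * int k) x"
      by (simp add: cell_def Z2_plane_def S_inv_pow_even)
    then show ?thesis using cell_antimono[OF k, of x] cell_eq[OF x] by blast
  qed
  then show "\<exists>e>0. \<forall>y. dist y x < e \<longrightarrow> y \<in> cell j a"
    by (intro exI[of _ "(1 / 2) ^ k"]) auto
qed

text \<open>Together with the next lemma: for fixed \<open>j\<close>, the cells \<open>S\<^sup>j n + S\<^sup>j \<int>\<^sub>2\<^sup>2\<close> with \<open>n\<close> among the
  representatives partition the plane.\<close>

lemma ex_frac_rep_cell: "\<exists>n\<in>frac_reps_plane. a \<in> cell j (S_pow j n)"
proof -
  obtain n1 n2 where "n1 \<in> frac_reps" "n2 \<in> frac_reps"
    "S_inv_pow j a $ 1 - n1 \<in> Z2" "S_inv_pow j a $ 2 - n2 \<in> Z2"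
    using ex_frac_rep by meson
  then show ?thesis
    by (intro bexI[of _ "vector [n1, n2]"])
       (simp_all add: frac_reps_plane_def cell_def S_inv_pow_diff S_inv_pow_S_pow Z2_plane_def)
qed

lemma frac_rep_cell_unique:
  assumes "m \<in> frac_reps_plane" "n \<in> frac_reps_plane" "S_pow j m \<in> cell j (S_pow j n)"
  shows "m = n"
  using assms frac_rep_unique[of "m $ 1" "n $ 1"] frac_rep_unique[of "m $ 2" "n $ 2"]
  by (auto simp: vec_eq_iff forall_2 frac_reps_plane_def cell_def S_inv_pow_diff
      S_inv_pow_S_pow Z2_plane_def)

lemma countable_frac_reps_plane: "countable frac_reps_plane"
proof -
  have "frac_reps \<subseteq> (\<lambda>(N :: nat, k :: nat). of_nat N / 2 ^ k) ` UNIV"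
    using frac_reps_imp_dyadic_fraction by fast
  then have c: "countable frac_reps" by (rule countable_subset) simp
  have "frac_reps_plane \<subseteq> (\<lambda>(a, b). vector [a, b]) ` (frac_reps \<times> frac_reps)"
  proof
    fix n assume "n \<in> frac_reps_plane"
    moreover have "n = vector [n $ 1, n $ 2]" by (simp add: vec_eq_iff forall_2)
    ultimately show "n \<in> (\<lambda>(a, b). vector [a, b]) ` (frac_reps \<times> frac_reps)"
      by (auto simp: frac_reps_plane_def image_iff intro!: bexI[of _ "(n $ 1, n $ 2)"])
  qed
  then show ?thesis by (rule countable_subset) (simp add: c)
qed

definition cells :: "(q2^2) set set" where
  "cells = (\<lambda>(j, n). cell j (S_pow j n)) ` (UNIV \<times> frac_reps_plane)"

lemma countable_cells: "countable cells"
  by (simp add: cells_def countable_frac_reps_plane)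

lemma cell_in_cells: "cell j a \<in> cells"
  using ex_frac_rep_cell[of a j] cell_eq unfolding cells_def by force

lemma open_eq_Union_cells:
  assumes "open U" shows "U = \<Union>{C \<in> cells. C \<subseteq> U}"
proof (intro equalityI subsetI)
  fix x assume "x \<in> U"
  then obtain e where "e > 0" "ball x e \<subseteq> U" using assms openE by blast
  then obtain j where "cell j x \<subseteq> U" using small_cell_subset_ball by blast
  then show "x \<in> \<Union>{C \<in> cells. C \<subseteq> U}" using cell_self cell_in_cells by blast
qed blast

text \<open>An open set is the union of the cells in it, and there are only countably many cells.\<close>

lemma borel_plane_eq_sigma_cells:
  "sets (borel :: (q2^2) measure) = sigma_sets UNIV (insert {} cells)"
proof -
  have *: "U \<in> sigma_sets UNIV (insert {} cells)" if "open U" for U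
  proof -
    have "countable {C \<in> cells. C \<subseteq> U}" using countable_cells by simp
    then have "\<Union>{C \<in> cells. C \<subseteq> U} \<in> sigma_sets UNIV (insert {} cells)"
      by (rule sigma_sets_UNION) auto
    then show ?thesis using open_eq_Union_cells[OF that] by simp
  qed
  have "sigma_sets UNIV {U. open U} = sigma_sets UNIV (insert {} cells)"
    using * by (intro sigma_sets_eqI) (auto simp: cells_def intro!: sigma_sets.Basic open_cell)
  then show ?thesis by (simp add: borel_def)
qed

lemma Int_stable_cells: "Int_stable (insert {} cells)"
proof (rule Int_stableI)
  have *: "cell j a \<inter> cell k b \<in> insert {} cells" if "j \<le> k" for j k a b
  proof (cases "cell k b \<subseteq> cell j a")
    case True
    then show ?thesis using cell_in_cells by (simp add: Int_absorb1)
  next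
    case False
    then have "cell j a \<inter> cell k b = {}" using cell_subset_or_disjoint[OF that, of b a] by blast
    then show ?thesis by simp
  qed
  have **: "cell j a \<inter> cell k b \<in> insert {} cells" for j k a b
  proof (cases "j \<le> k")
    case False
    then show ?thesis using *[of k j b a] by (simp only: Int_commute)
  qed (rule *)
  fix C D assume "C \<in> insert {} cells" "D \<in> insert {} cells"
  then consider "C = {}" | "D = {}" | j a k b where "C = cell j a" "D = cell k b"
    by (auto simp: cells_def)
  then show "C \<inter> D \<in> insert {} cells"
    using ** by cases simp_all
qed

section \<open>Closed subspaces of square-integrable functions\<close>

text \<open>This weak form of the triangle inequality for squared norms is enough for the approximation
  arguments below: only smallness of the right-hand side matters, so the factor 2 does no harm.\<close>

lemma cmod_add_squared_le: "(cmod (a + b))\<^sup>2 \<le> 2 * (cmod a)\<^sup>2 + 2 * (cmod b)\<^sup>2"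
proof -
  have "(cmod (a + b))\<^sup>2 \<le> (cmod a + cmod b)\<^sup>2"
    by (intro power_mono norm_triangle_ineq) simp
  also have "\<dots> \<le> 2 * (cmod a)\<^sup>2 + 2 * (cmod b)\<^sup>2"
    using sum_squares_bound[of "cmod a" "cmod b"] by (simp add: power2_sum)
  finally show ?thesis .
qed

lemma L2_measurable: "f \<in> L2 M \<Longrightarrow> f \<in> borel_measurable M"
  and L2_integrable: "f \<in> L2 M \<Longrightarrow> integrable M (\<lambda>x. (cmod (f x))\<^sup>2)"
  by (simp_all add: L2_def)

lemma L2_zero: "(\<lambda>_. 0) \<in> L2 M"
  by (simp add: L2_def)

lemma L2_scale: "f \<in> L2 M \<Longrightarrow> (\<lambda>x. c * f x) \<in> L2 M"
  by (auto simp: L2_def norm_mult power_mult_distrib)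

lemma L2_add:
  assumes "f \<in> L2 M" "g \<in> L2 M"
  shows "(\<lambda>x. f x + g x) \<in> L2 M"
proof -
  have [measurable]: "f \<in> borel_measurable M" "g \<in> borel_measurable M"
    using assms by (auto intro: L2_measurable)
  have "integrable M (\<lambda>x. 2 * (cmod (f x))\<^sup>2 + 2 * (cmod (g x))\<^sup>2)"
    using assms by (auto intro!: L2_integrable)
  then have "integrable M (\<lambda>x. (cmod (f x + g x))\<^sup>2)"
    by (rule Bochner_Integration.integrable_bound) (auto simp: cmod_add_squared_le)
  then show ?thesis by (simp add: L2_def)
qed

lemma L2_diff:
  assumes "f \<in> L2 M" "g \<in> L2 M"
  shows "(\<lambda>x. f x - g x) \<in> L2 M"
  using L2_add[OF assms(1) L2_scale[OF assms(2), of "-1"]] by simp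

lemma L2_sum:
  assumes "\<And>i. i \<in> F \<Longrightarrow> f i \<in> L2 M"
  shows "(\<lambda>x. \<Sum>i\<in>F. f i x) \<in> L2 M"
  using assms by (induction F rule: infinite_finite_induct) (simp_all add: L2_zero L2_add)

lemma L2_indicator:
  assumes "A \<in> sets M" "emeasure M A < \<infinity>"
  shows "indicator A \<in> L2 M"
proof -
  have "(\<lambda>x. (cmod (indicator A x))\<^sup>2) = (indicator A :: _ \<Rightarrow> real)"
    by (auto simp: indicator_def)
  then show ?thesis
    using assms by (simp add: L2_def integrable_indicator_iff)
qed

lemma integral_cmod_add_squared_le:
  assumes "f \<in> L2 M" "g \<in> L2 M"
  shows "(\<integral>x. (cmod (f x + g x))\<^sup>2 \<partial>M)
    \<le> 2 * (\<integral>x. (cmod (f x))\<^sup>2 \<partial>M) + 2 * (\<integral>x. (cmod (g x))\<^sup>2 \<partial>M)"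
proof -
  have "(\<integral>x. (cmod (f x + g x))\<^sup>2 \<partial>M) \<le> (\<integral>x. 2 * (cmod (f x))\<^sup>2 + 2 * (cmod (g x))\<^sup>2 \<partial>M)"
    using assms L2_add[OF assms]
    by (intro integral_mono) (auto intro!: L2_integrable cmod_add_squared_le)
  also have "\<dots> = 2 * (\<integral>x. (cmod (f x))\<^sup>2 \<partial>M) + 2 * (\<integral>x. (cmod (g x))\<^sup>2 \<partial>M)"
    using assms by (simp add: L2_integrable)
  finally show ?thesis .
qed

text \<open>The functions are not identified modulo null sets, so closedness also says that \<open>H\<close> contains
  every square-integrable function that agrees almost everywhere with a member of \<open>H\<close>.\<close>

locale L2_closed_subspace =
  fixes M :: "'a measure" and H :: "('a \<Rightarrow> complex) set"
  assumes subset_L2: "H \<subseteq> L2 M"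
    and zero: "(\<lambda>_. 0) \<in> H"
    and add: "f \<in> H \<Longrightarrow> g \<in> H \<Longrightarrow> (\<lambda>x. f x + g x) \<in> H"
    and scale: "f \<in> H \<Longrightarrow> (\<lambda>x. c * f x) \<in> H"
    and closed: "f \<in> L2 M \<Longrightarrow>
      (\<And>\<epsilon>. \<epsilon> > 0 \<Longrightarrow> \<exists>g\<in>H. (\<integral>x. (cmod (f x - g x))\<^sup>2 \<partial>M) < \<epsilon>) \<Longrightarrow> f \<in> H"
begin

lemma diff: "f \<in> H \<Longrightarrow> g \<in> H \<Longrightarrow> (\<lambda>x. f x - g x) \<in> H"
  using add[of f "\<lambda>x. - 1 * g x"] scale[of g "- 1"] by simp

lemma sum: "(\<And>i. i \<in> F \<Longrightarrow> f i \<in> H) \<Longrightarrow> (\<lambda>x. \<Sum>i\<in>F. f i x) \<in> H"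
  by (induction F rule: infinite_finite_induct) (simp_all add: zero add)

text \<open>Dominated convergence for the squared distance, with a multiple of \<open>\<bar>f\<bar>\<^sup>2\<close> as the majorant.\<close>

lemma dominated_limit:
  assumes f: "f \<in> L2 M" and g: "\<And>n. g n \<in> H"
    and lim: "\<And>x. x \<in> space M \<Longrightarrow> (\<lambda>n. g n x) \<longlonglongrightarrow> f x"
    and bound: "\<And>n x. x \<in> space M \<Longrightarrow> cmod (g n x) \<le> C * cmod (f x)"
  shows "f \<in> H"
proof (rule closed[OF f])
  fix \<epsilon> :: real assume "\<epsilon> > 0"
  have [measurable]: "f \<in> borel_measurable M" "\<And>n. g n \<in> borel_measurable M"
    using f g subset_L2 by (auto intro!: L2_measurable)
  have "(\<lambda>n. \<integral>x. (cmod (f x - g n x))\<^sup>2 \<partial>M) \<longlonglongrightarrow> (\<integral>x. 0 \<partial>M)"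
  proof (rule integral_dominated_convergence[where w = "\<lambda>x. (1 + C)\<^sup>2 * (cmod (f x))\<^sup>2"])
    show "AE x in M. (\<lambda>n. (cmod (f x - g n x))\<^sup>2) \<longlonglongrightarrow> 0"
    proof (rule AE_I2)
      fix x assume "x \<in> space M"
      then have "(\<lambda>n. (cmod (f x - g n x))\<^sup>2) \<longlonglongrightarrow> (cmod (f x - f x))\<^sup>2"
        by (intro tendsto_intros lim)
      then show "(\<lambda>n. (cmod (f x - g n x))\<^sup>2) \<longlonglongrightarrow> 0" by simp
    qed
    show "AE x in M. norm ((cmod (f x - g n x))\<^sup>2) \<le> (1 + C)\<^sup>2 * (cmod (f x))\<^sup>2" for n
    proof (rule AE_I2)
      fix x assume "x \<in> space M"
      then have "cmod (f x - g n x) \<le> (1 + C) * cmod (f x)"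
        using norm_triangle_ineq4[of "f x" "g n x"] bound[of x n] by (simp add: algebra_simps)
      then have "(cmod (f x - g n x))\<^sup>2 \<le> ((1 + C) * cmod (f x))\<^sup>2"
        by (rule power_mono) simp
      then show "norm ((cmod (f x - g n x))\<^sup>2) \<le> (1 + C)\<^sup>2 * (cmod (f x))\<^sup>2"
        by (simp add: power_mult_distrib)
    qed
  qed (use f in \<open>auto intro: L2_integrable\<close>)
  then have "\<forall>\<^sub>F n in sequentially. (\<integral>x. (cmod (f x - g n x))\<^sup>2 \<partial>M) < \<epsilon>"
    by (rule order_tendstoD(2)) (simp add: \<open>\<epsilon> > 0\<close>)
  then show "\<exists>h\<in>H. (\<integral>x. (cmod (f x - h x))\<^sup>2 \<partial>M) < \<epsilon>"
    using g by (auto simp: eventually_sequentially)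
qed

lemma indicator_disjoint_Union:
  fixes A :: "nat \<Rightarrow> 'a set"
  assumes "disjoint_family A" "\<And>i. A i \<in> sets M" "emeasure M (\<Union>i. A i) < \<infinity>"
    and ind: "\<And>i. indicator (A i) \<in> H"
  shows "indicator (\<Union>i. A i) \<in> H"
proof (rule dominated_limit[where C = 1 and g = "\<lambda>n x. \<Sum>i<n. indicator (A i) x"])
  have eq: "(\<Sum>i<n. indicator (A i) x) = (indicator (\<Union>i<n. A i) x :: complex)" for n x
    using assms(1)
    by (intro indicator_UN_disjoint[symmetric]) (auto simp: disjoint_family_on_def)
  show "(\<lambda>n. \<Sum>i<n. indicator (A i) x) \<longlonglongrightarrow> (indicator (\<Union>i. A i) x :: complex)" for x
    unfolding eq by (rule LIMSEQ_indicator_UN)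
  show "cmod (\<Sum>i<n. indicator (A i) x) \<le> 1 * cmod (indicator (\<Union>i. A i) x)" for n x
    unfolding eq by (auto simp: indicator_def)
qed (use assms in \<open>auto intro!: L2_indicator sum\<close>)

text \<open>A Dynkin argument. It is run inside a fixed member \<open>B\<close> of the generator, so that all complements
  have finite measure; a countable cover by members of the generator then cuts an arbitrary set of
  finite measure into such pieces.\<close>

lemma indicator_from_generator:
  assumes gen: "sets M = sigma_sets \<Omega> P" "P \<subseteq> Pow \<Omega>" "Int_stable P"
    and P: "\<And>B. B \<in> P \<Longrightarrow> emeasure M B < \<infinity>" "\<And>B. B \<in> P \<Longrightarrow> indicator B \<in> H"
    and cover: "countable Q" "Q \<subseteq> P" "\<Union>Q = \<Omega>"
    and A: "A \<in> sets M" "emeasure M A < \<infinity>"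
  shows "indicator A \<in> H"
proof -
  have PM: "B \<in> sets M" if "B \<in> P" for B
    using that gen(1) by (simp add: sigma_sets.Basic)
  have inter: "indicator (D \<inter> B) \<in> H" if B: "B \<in> P" and D: "D \<in> sets M" for B D
    using gen(3) gen(2) D[unfolded gen(1)]
  proof (induction D rule: sigma_sets_induct_disjoint)
    case (basic D)
    then show ?case using gen(3) B P(2) by (auto simp: Int_stable_def)
  next
    case empty
    then show ?case using zero by simp
  next
    case (compl D)
    have "indicator ((\<Omega> - D) \<inter> B) = (\<lambda>x. indicator B x - indicator (D \<inter> B) x :: complex)"
      using B gen(2) by (auto simp: indicator_def fun_eq_iff)
    then show ?case using diff[OF P(2)[OF B] compl.IH] by simp
  next
    case (union D)
    have D: "D i \<in> sets M" for i using union.hyps gen(1) by auto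
    have "emeasure M (\<Union>i. D i \<inter> B) \<le> emeasure M B"
      using PM[OF B] by (intro emeasure_mono) auto
    then have "emeasure M (\<Union>i. D i \<inter> B) < \<infinity>" using P(1)[OF B] by simp
    then have "indicator (\<Union>i. D i \<inter> B) \<in> H"
      using union D PM[OF B]
      by (intro indicator_disjoint_Union) (auto simp: disjoint_family_on_def)
    then show ?case by simp
  qed
  show ?thesis
  proof (cases "Q = {}")
    case True
    then have "\<Omega> = {}" using cover(3) by simp
    then have "A = {}" using sigma_sets_into_sp[OF gen(2) A(1)[unfolded gen(1)]] by simp
    then show ?thesis using zero by (simp add: indicator_def[abs_def])
  next
    case False
    define B where "B = from_nat_into Q"
    have B: "B i \<in> P" for i using from_nat_into[OF False] cover(2) by (auto simp: B_def)
    have UB: "(\<Union>i. B i) = \<Omega>"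
      using range_from_nat_into[OF False cover(1)] cover(3) by (simp add: B_def)
    define D where "D i = (A - (\<Union>k<i. B k)) \<inter> B i" for i
    have "A \<subseteq> \<Omega>" by (rule sigma_sets_into_sp[OF gen(2) A(1)[unfolded gen(1)]])
    have D_eq: "D i = A \<inter> disjointed B i" for i
      by (auto simp: D_def disjointed_def lessThan_atLeast0)
    have UD: "(\<Union>i. D i) = A"
      using \<open>A \<subseteq> \<Omega>\<close> UB UN_disjointed_eq[of B] by (auto simp: D_eq)
    have "indicator (\<Union>i. D i) \<in> H"
    proof (rule indicator_disjoint_Union)
      show "disjoint_family D"
        using disjoint_family_disjointed[of B] by (auto simp: D_eq disjoint_family_on_def)
      show "D i \<in> sets M" for i using A(1) PM[OF B] by (auto simp: D_def)
      show "emeasure M (\<Union>i. D i) < \<infinity>" using A(2) by (simp add: UD)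
      show "indicator (D i) \<in> H" for i
        unfolding D_def using A(1) PM[OF B] by (intro inter B) auto
    qed
    then show ?thesis by (simp add: UD)
  qed
qed

text \<open>A function in \<open>L\<^sup>2\<close> is a pointwise limit of simple functions bounded by twice its modulus.
  The level sets of these at nonzero values have finite measure.\<close>

lemma eq_L2_if_indicators:
  assumes ind: "\<And>A. A \<in> sets M \<Longrightarrow> emeasure M A < \<infinity> \<Longrightarrow> indicator A \<in> H"
  shows "H = L2 M"
proof (intro equalityI subset_L2 subsetI)
  fix f assume f: "f \<in> L2 M"
  obtain s where s: "\<And>i. simple_function M (s i)"
      "\<And>x. x \<in> space M \<Longrightarrow> (\<lambda>i. s i x) \<longlonglongrightarrow> f x"
      "\<And>i x. x \<in> space M \<Longrightarrow> cmod (s i x) \<le> 2 * cmod (f x)"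
    using borel_measurable_implies_sequence_metric[OF L2_measurable[OF f], of 0]
    by (simp add: dist_norm) metis
  define level where "level i c = s i -` {c} \<inter> space M" for i c
  define g where "g i x = (\<Sum>c\<in>s i ` space M. c * indicator (level i c) x)" for i x
  have g_eq: "g i x = s i x" if "x \<in> space M" for i x
  proof -
    have "g i x = (\<Sum>c\<in>s i ` space M. if c = s i x then c else 0)"
      unfolding g_def using that by (intro sum.cong) (auto simp: level_def indicator_def)
    also have "\<dots> = s i x"
      using that simple_functionD(1)[OF s(1)] by (subst sum.delta) auto
    finally show ?thesis .
  qed
  have level: "level i c \<in> sets M" for i c
    unfolding level_def by (rule simple_functionD(2)[OF s(1)])
  have "(\<lambda>x. c * indicator (level i c) x) \<in> H" for i c
  proof (cases "c = 0")
    case False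
    have "integrable M (\<lambda>x. 4 / (cmod c)\<^sup>2 * (cmod (f x))\<^sup>2)"
      using L2_integrable[OF f] by simp
    then have "integrable M (indicator (level i c) :: 'a \<Rightarrow> real)"
    proof (rule Bochner_Integration.integrable_bound)
      show "AE x in M. norm (indicator (level i c) x :: real) \<le> norm (4 / (cmod c)\<^sup>2 * (cmod (f x))\<^sup>2)"
      proof (rule AE_I2)
        fix x assume x: "x \<in> space M"
        show "norm (indicator (level i c) x :: real) \<le> norm (4 / (cmod c)\<^sup>2 * (cmod (f x))\<^sup>2)"
        proof (cases "s i x = c")
          case True
          then have "(cmod c)\<^sup>2 \<le> (2 * cmod (f x))\<^sup>2"
            using s(3)[OF x, of i] by (intro power_mono) auto
          then show ?thesis using False by (simp add: indicator_def field_simps)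
        next
          case False
          then show ?thesis by (simp add: level_def indicator_def)
        qed
      qed
    qed (use level in simp)
    then have "emeasure M (level i c) < \<infinity>"
      using level by (simp add: integrable_indicator_iff)
    then show ?thesis by (intro scale ind level)
  qed (simp add: zero)
  then have "g i \<in> H" for i
    unfolding g_def[abs_def] by (intro sum)
  then show "f \<in> H"
  proof (rule dominated_limit[OF f, where C = 2])
    show "(\<lambda>i. g i x) \<longlonglongrightarrow> f x" if "x \<in> space M" for x
      unfolding g_eq[OF that] by (rule s(2)[OF that])
    show "cmod (g i x) \<le> 2 * cmod (f x)" if "x \<in> space M" for i x
      unfolding g_eq[OF that] by (rule s(3)[OF that])
  qed
qed

end

text \<open>The closure is expressed by the squared distance, to which the inequality
  \<open>integral_cmod_add_squared_le\<close> applies.\<close>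

definition L2_closed_span :: "'a measure \<Rightarrow> 'i set \<Rightarrow> ('i \<Rightarrow> 'a \<Rightarrow> complex) \<Rightarrow> ('a \<Rightarrow> complex) set" where
  "L2_closed_span M I e = {f \<in> L2 M. \<forall>\<epsilon>>0. \<exists>F c. finite F \<and> F \<subseteq> I \<and>
     (\<integral>x. (cmod (f x - (\<Sum>i\<in>F. c i * e i x)))\<^sup>2 \<partial>M) < \<epsilon>}"

lemma basis_in_L2_closed_span:
  assumes "i \<in> I" "e i \<in> L2 M"
  shows "e i \<in> L2_closed_span M I e"
proof -
  have "\<exists>F c. finite F \<and> F \<subseteq> I \<and>
     (\<integral>x. (cmod (e i x - (\<Sum>k\<in>F. c k * e k x)))\<^sup>2 \<partial>M) < \<epsilon>" if "\<epsilon> > 0" for \<epsilon> :: real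
    using assms that by (intro exI[of _ "{i}"] exI[of _ "\<lambda>_. 1"]) simp
  then show ?thesis using assms by (simp add: L2_closed_span_def)
qed

lemma L2_closed_subspace_closed_span:
  assumes e: "\<And>i. i \<in> I \<Longrightarrow> e i \<in> L2 M"
  shows "L2_closed_subspace M (L2_closed_span M I e)"
proof
  let ?H = "L2_closed_span M I e"
  let ?sq = "\<lambda>f. \<integral>x. (cmod (f x))\<^sup>2 \<partial>M"
  have comb: "(\<lambda>x. \<Sum>i\<in>F. c i * e i x) \<in> L2 M" if "F \<subseteq> I" for F c
    using that e by (auto intro!: L2_sum L2_scale)
  show "?H \<subseteq> L2 M" by (auto simp: L2_closed_span_def)
  show "(\<lambda>_. 0) \<in> ?H"
    by (auto simp: L2_closed_span_def L2_zero intro!: exI[of _ "{}"])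
  show "(\<lambda>x. f x + g x) \<in> ?H" if f: "f \<in> ?H" and g: "g \<in> ?H" for f g
  proof -
    have fg: "f \<in> L2 M" "g \<in> L2 M" using f g by (auto simp: L2_closed_span_def)
    have "\<exists>F c. finite F \<and> F \<subseteq> I \<and> ?sq (\<lambda>x. f x + g x - (\<Sum>i\<in>F. c i * e i x)) < \<epsilon>"
      if "\<epsilon> > 0" for \<epsilon>
    proof -
      have "\<epsilon> / 4 > 0" using that by simp
      then obtain F c G d where F: "finite F" "F \<subseteq> I" "?sq (\<lambda>x. f x - (\<Sum>i\<in>F. c i * e i x)) < \<epsilon> / 4"
        and G: "finite G" "G \<subseteq> I" "?sq (\<lambda>x. g x - (\<Sum>i\<in>G. d i * e i x)) < \<epsilon> / 4"
        using f g unfolding L2_closed_span_def by blast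
      define b where "b i = (if i \<in> F then c i else 0) + (if i \<in> G then d i else 0)" for i
      have "(\<Sum>i\<in>F \<union> G. b i * e i x) = (\<Sum>i\<in>F. c i * e i x) + (\<Sum>i\<in>G. d i * e i x)" for x
      proof -
        have "(\<Sum>i\<in>F \<union> G. b i * e i x)
            = (\<Sum>i\<in>F \<union> G. if i \<in> F then c i * e i x else 0) + (\<Sum>i\<in>F \<union> G. if i \<in> G then d i * e i x else 0)"
          unfolding sum.distrib[symmetric] by (intro sum.cong) (auto simp: b_def algebra_simps)
        also have "\<dots> = (\<Sum>i\<in>F. c i * e i x) + (\<Sum>i\<in>G. d i * e i x)"
          using F(1) G(1) by (simp add: sum.If_cases Int_absorb1 Int_Un_distrib2)
        finally show ?thesis .
      qed
      then have "?sq (\<lambda>x. f x + g x - (\<Sum>i\<in>F \<union> G. b i * e i x))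
          = ?sq (\<lambda>x. (f x - (\<Sum>i\<in>F. c i * e i x)) + (g x - (\<Sum>i\<in>G. d i * e i x)))"
        by (simp add: algebra_simps)
      also have "\<dots> \<le> 2 * ?sq (\<lambda>x. f x - (\<Sum>i\<in>F. c i * e i x)) + 2 * ?sq (\<lambda>x. g x - (\<Sum>i\<in>G. d i * e i x))"
        using fg F(2) G(2) by (intro integral_cmod_add_squared_le L2_diff comb)
      also have "\<dots> < \<epsilon>" using F(3) G(3) by simp
      finally show ?thesis using F(1,2) G(1,2) by (intro exI[of _ "F \<union> G"] exI[of _ b]) auto
    qed
    then show ?thesis using fg by (simp add: L2_closed_span_def L2_add)
  qed
  show "(\<lambda>x. a * f x) \<in> ?H" if f: "f \<in> ?H" for a f
  proof -
    have "\<exists>F c. finite F \<and> F \<subseteq> I \<and> ?sq (\<lambda>x. a * f x - (\<Sum>i\<in>F. c i * e i x)) < \<epsilon>"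
      if "\<epsilon> > 0" for \<epsilon>
    proof -
      have pos: "1 + (cmod a)\<^sup>2 > 0" by (simp add: add_pos_nonneg)
      then have "\<epsilon> / (1 + (cmod a)\<^sup>2) > 0" using that by simp
      then obtain F c where F: "finite F" "F \<subseteq> I"
          "?sq (\<lambda>x. f x - (\<Sum>i\<in>F. c i * e i x)) < \<epsilon> / (1 + (cmod a)\<^sup>2)"
        using f unfolding L2_closed_span_def by blast
      have "?sq (\<lambda>x. a * f x - (\<Sum>i\<in>F. a * c i * e i x)) = ?sq (\<lambda>x. a * (f x - (\<Sum>i\<in>F. c i * e i x)))"
        by (simp add: right_diff_distrib sum_distrib_left mult.assoc)
      also have "\<dots> = (cmod a)\<^sup>2 * ?sq (\<lambda>x. f x - (\<Sum>i\<in>F. c i * e i x))"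
        by (simp add: norm_mult power_mult_distrib)
      also have "\<dots> \<le> (1 + (cmod a)\<^sup>2) * ?sq (\<lambda>x. f x - (\<Sum>i\<in>F. c i * e i x))"
        by (intro mult_right_mono) auto
      also have "\<dots> < \<epsilon>" using F(3) pos by (simp add: field_simps)
      finally show ?thesis using F(1,2) by (intro exI[of _ F] exI[of _ "\<lambda>i. a * c i"]) auto
    qed
    then show ?thesis using f by (simp add: L2_closed_span_def L2_scale)
  qed
  show "f \<in> ?H" if f: "f \<in> L2 M"
    and approx: "\<And>\<epsilon>. \<epsilon> > 0 \<Longrightarrow> \<exists>g\<in>?H. ?sq (\<lambda>x. f x - g x) < \<epsilon>" for f
  proof -
    have "\<exists>F c. finite F \<and> F \<subseteq> I \<and> ?sq (\<lambda>x. f x - (\<Sum>i\<in>F. c i * e i x)) < \<epsilon>"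
      if "\<epsilon> > 0" for \<epsilon>
    proof -
      have pos: "\<epsilon> / 4 > 0" using that by simp
      then obtain g where g: "g \<in> ?H" "?sq (\<lambda>x. f x - g x) < \<epsilon> / 4" using approx by blast
      then obtain F c where F: "finite F" "F \<subseteq> I" "?sq (\<lambda>x. g x - (\<Sum>i\<in>F. c i * e i x)) < \<epsilon> / 4"
        using pos unfolding L2_closed_span_def by blast
      have gL: "g \<in> L2 M" using g(1) by (simp add: L2_closed_span_def)
      have "?sq (\<lambda>x. f x - (\<Sum>i\<in>F. c i * e i x))
          = ?sq (\<lambda>x. (f x - g x) + (g x - (\<Sum>i\<in>F. c i * e i x)))" by simp
      also have "\<dots> \<le> 2 * ?sq (\<lambda>x. f x - g x) + 2 * ?sq (\<lambda>x. g x - (\<Sum>i\<in>F. c i * e i x))"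
        using f gL F(2) by (intro integral_cmod_add_squared_le L2_diff comb)
      also have "\<dots> < \<epsilon>" using g(2) F(3) by simp
      finally show ?thesis using F(1,2) by blast
    qed
    then show ?thesis using f by (simp add: L2_closed_span_def)
  qed
qed

lemma L2_orthonormal_basis_if_closed_span:
  assumes "\<And>i. i \<in> I \<Longrightarrow> e i \<in> L2 M"
    and "\<And>i k. i \<in> I \<Longrightarrow> k \<in> I \<Longrightarrow> L2_inner M (e i) (e k) = (if i = k then 1 else 0)"
    and "L2_closed_span M I e = L2 M"
  shows "L2_orthonormal_basis M I e"
proof -
  have "\<exists>F c. finite F \<and> F \<subseteq> I \<and> L2_norm M (\<lambda>x. f x - (\<Sum>i\<in>F. c i * e i x)) < \<epsilon>"
    if "f \<in> L2 M" "\<epsilon> > 0" for f \<epsilon>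
  proof -
    have "f \<in> L2_closed_span M I e" "\<epsilon>\<^sup>2 > 0" using that assms(3) by auto
    then obtain F c where F: "finite F" "F \<subseteq> I"
        "(\<integral>x. (cmod (f x - (\<Sum>i\<in>F. c i * e i x)))\<^sup>2 \<partial>M) < \<epsilon>\<^sup>2"
      unfolding L2_closed_span_def by blast
    then have "L2_norm M (\<lambda>x. f x - (\<Sum>i\<in>F. c i * e i x)) < \<epsilon>"
      unfolding L2_norm_def using that(2) by (intro real_less_lsqrt) auto
    then show ?thesis using F(1,2) by blast
  qed
  then show ?thesis using assms(1,2) by (simp add: L2_orthonormal_basis_def)
qed

section \<open>The wavelet system\<close>

text \<open>The point \<open>a\<close> may be any point of the cell, not only the representative; moving it within the cell
  changes at most the sign.\<close>

definition wavelet :: "int \<Rightarrow> q2^2 \<Rightarrow> q2^2 \<Rightarrow> real" where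
  "wavelet j a x = indicator (cell (j + 1) a) x - indicator (cell (j + 1) (a + shift j)) x"

lemma Omega_vnorm2: "Omega (vnorm2 x) = indicator Z2_plane x"
  by (auto simp: Omega_def vnorm2_def Z2_plane_def Z2_def indicator_def le_max_iff_disj)

text \<open>The vector \<open>(1/2, 0)\<close> in the definition of \<open>\<theta>\<close> is \<open>S\<^sup>-\<^sup>1 (0, 1)\<close>, so the second term is the first one
  translated by \<open>(0, 1)\<close>.\<close>

lemma theta_S_inv_pow: "theta (S_inv_pow j (x - a)) = wavelet j a x"
proof -
  have half: "vector [1 / 2, 0] = matrix_inv S *v (axis 2 1 :: q2^2)"
    by (simp add: matrix_inv_S vec_eq_iff forall_2 matrix_vector_mult_def sum_2 axis_def)
  have "matrix_inv S *v S_inv_pow j (x - a) - vector [1 / 2, 0]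
      = matrix_inv S *v (S_inv_pow j (x - a) - S_inv_pow j (shift j))"
    by (simp add: half S_inv_pow_shift matrix_vector_mult_diff_distrib)
  also have "\<dots> = S_inv_pow (j + 1) (x - (a + shift j))"
    by (simp only: S_inv_pow_add_one S_inv_pow_diff[symmetric] diff_diff_eq)
  finally show ?thesis
    by (simp add: theta_def Omega_vnorm2 wavelet_def S_inv_pow_add_one[symmetric] cell_def indicator_def)
qed

lemma theta_jn_eq_wavelet: "theta_jn j n x = 2 powr (real_of_int j / 2) * wavelet j (S_pow j n) x"
  unfolding theta_jn_def theta_S_inv_pow[symmetric]
  by (simp add: S_inv_pow_diff S_inv_pow_S_pow) (simp add: S_inv_pow_def)

lemma indicator_cell_split:
  "indicator (cell j a) x = (indicator (cell (j + 1) a) x + indicator (cell (j + 1) (a + shift j)) x :: 'a :: ring_1)"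
  unfolding cell_split(1)[of j a] using cell_split(2)[of j a] by (auto simp: indicator_def)

lemma wavelet_eq_0: "x \<notin> cell j a \<Longrightarrow> wavelet j a x = 0"
  using cell_split(1)[of j a] by (simp add: wavelet_def)

lemma wavelet_squared: "wavelet j a x * wavelet j a x = indicator (cell j a) x"
  unfolding indicator_cell_split[of j a] using cell_split(2)[of j a] by (auto simp: wavelet_def indicator_def)

lemma wavelet_const_on_smaller_cell:
  assumes "j < k" "x \<in> cell k b"
  shows "wavelet j a x = wavelet j a b"
proof -
  have "x \<in> cell (j + 1) b" using cell_antimono[of "j + 1" k b] assms by auto
  then have "cell (j + 1) x = cell (j + 1) b" by (rule cell_eq)
  then have "x \<in> cell (j + 1) c \<longleftrightarrow> b \<in> cell (j + 1) c" for c
    using cell_commute[of x "j + 1" c] cell_commute[of b "j + 1" c] by simp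
  then show ?thesis by (simp add: wavelet_def indicator_def)
qed

locale unit_haar_plane =
  fixes \<mu> :: "(q2^2) measure"
  assumes haar: "haar_measure \<mu>" and unit: "emeasure \<mu> Z2_plane = 1"
begin

lemma sets_eq: "sets \<mu> = sets borel"
  using haar by (simp add: haar_measure_def)

lemma space_eq: "space \<mu> = UNIV"
  using sets_eq_imp_space_eq[OF sets_eq] by simp

lemma cell_sets [measurable]: "cell j a \<in> sets \<mu>"
  by (simp add: sets_eq open_cell)

lemma emeasure_cell_translate: "emeasure \<mu> (cell j a) = emeasure \<mu> (cell j b)"
proof -
  have "emeasure \<mu> ((+) (a - b) ` cell j b) = emeasure \<mu> (cell j b)"
    using haar cell_sets[of j b] unfolding haar_measure_def by blast
  then show ?thesis by (simp add: cell_translate)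
qed

lemma emeasure_cell_halve: "emeasure \<mu> (cell j a) = 2 * emeasure \<mu> (cell (j + 1) b)"
proof -
  have "emeasure \<mu> (cell j a) = emeasure \<mu> (cell (j + 1) a) + emeasure \<mu> (cell (j + 1) (a + shift j))"
    unfolding cell_split(1)[of j a]
    by (rule plus_emeasure[symmetric]) (use cell_split(2) cell_sets in auto)
  then show ?thesis
    using emeasure_cell_translate[of "j + 1" a b] emeasure_cell_translate[of "j + 1" "a + shift j" b]
    by (simp add: mult_2)
qed

text \<open>Both halves of a cell are translates of each other, so each level halves the measure, starting
  from measure one at level 0.\<close>

lemma emeasure_cell: "emeasure \<mu> (cell j a) = ennreal (2 powr - real_of_int j)"
proof (induction j arbitrary: a rule: int_induct[of _ 0])
  case base
  then show ?case
    using unit emeasure_cell_translate[of 0 a 0] by (simp add: cell_zero_zero)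
next
  case (step1 j)
  have eq: "2 * emeasure \<mu> (cell (j + 1) a) = ennreal (2 powr - real_of_int j)"
    using emeasure_cell_halve[of j a a] step1.IH by simp
  show ?case
  proof (cases "emeasure \<mu> (cell (j + 1) a)")
    case (real r)
    then have "ennreal (2 * r) = ennreal (2 powr - real_of_int j)"
      using eq by (simp add: ennreal_mult)
    then have "2 * r = 2 powr - real_of_int j"
      using real(1) by (subst (asm) ennreal_inj) auto
    then have "r = 2 powr - real_of_int (j + 1)"
      by (simp add: powr_diff)
    then show ?thesis using real by simp
  next
    case top
    then show ?thesis using eq by (simp add: ennreal_mult_top)
  qed
next
  case (step2 j)
  have "emeasure \<mu> (cell (j - 1) a) = 2 * ennreal (2 powr - real_of_int j)"
    using emeasure_cell_halve[of "j - 1" a a] step2.IH by simp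
  also have "\<dots> = ennreal (2 * 2 powr - real_of_int j)"
    by (simp add: ennreal_mult)
  also have "2 * 2 powr - real_of_int j = 2 powr - real_of_int (j - 1)"
    by (simp add: powr_diff powr_minus divide_inverse)
  finally show ?case .
qed

lemma measure_cell: "measure \<mu> (cell j a) = 2 powr - real_of_int j"
  by (simp add: measure_def emeasure_cell)

lemma emeasure_cell_finite: "emeasure \<mu> (cell j a) < \<infinity>"
  by (simp add: emeasure_cell)

lemma integrable_cell: "integrable \<mu> (indicator (cell j a) :: _ \<Rightarrow> real)"
  using emeasure_cell_finite by (simp add: integrable_indicator_iff)

lemma integral_wavelet: "(\<integral>x. wavelet j a x \<partial>\<mu>) = 0"
  using integrable_cell by (simp add: wavelet_def measure_cell space_eq)

text \<open>On the support of the finer wavelet, the coarser one is a constant, and the finer one has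
  integral zero.\<close>

lemma integral_wavelet_finer:
  assumes "j < k"
  shows "(\<integral>x. wavelet j a x * wavelet k b x \<partial>\<mu>) = 0"
proof -
  have eq: "wavelet j a x * wavelet k b x = wavelet j a b * wavelet k b x" for x
    using wavelet_const_on_smaller_cell[OF assms, of x b a] wavelet_eq_0[of x k b]
    by (cases "x \<in> cell k b") simp_all
  show ?thesis unfolding eq by (simp add: integral_wavelet)
qed

lemma integral_wavelet_disjoint:
  assumes "b \<notin> cell j a"
  shows "(\<integral>x. wavelet j a x * wavelet j b x \<partial>\<mu>) = 0"
proof -
  have eq: "wavelet j a x * wavelet j b x = 0" for x
    using cell_disjoint[OF assms] wavelet_eq_0[of x j a] wavelet_eq_0[of x j b] by auto
  show ?thesis unfolding eq by simp
qed

lemma integral_wavelet_squared: "(\<integral>x. wavelet j a x * wavelet j a x \<partial>\<mu>) = 2 powr - real_of_int j"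
  by (simp add: wavelet_squared measure_cell space_eq)

abbreviation haar_index :: "(int \<times> (q2^2)) set" where
  "haar_index \<equiv> UNIV \<times> frac_reps_plane"

abbreviation haar_family :: "int \<times> (q2^2) \<Rightarrow> q2^2 \<Rightarrow> complex" where
  "haar_family \<equiv> \<lambda>(j, n) x. complex_of_real (theta_jn j n x)"

lemma theta_jn_orthonormal:
  assumes "m \<in> frac_reps_plane" "n \<in> frac_reps_plane"
  shows "(\<integral>x. theta_jn j m x * theta_jn k n x \<partial>\<mu>) = (if (j, m) = (k, n) then 1 else 0)"
proof -
  have "theta_jn j m x * theta_jn k n x = 2 powr (real_of_int j / 2) * 2 powr (real_of_int k / 2) *
        (wavelet j (S_pow j m) x * wavelet k (S_pow k n) x)" for x
    by (simp add: theta_jn_eq_wavelet)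
  then have eq: "(\<integral>x. theta_jn j m x * theta_jn k n x \<partial>\<mu>)
      = 2 powr (real_of_int j / 2) * 2 powr (real_of_int k / 2) *
        (\<integral>x. wavelet j (S_pow j m) x * wavelet k (S_pow k n) x \<partial>\<mu>)"
    by (simp only: integral_mult_right_zero)
  consider "j < k" | "k < j" | "j = k" "m \<noteq> n" | "j = k" "m = n" by linarith
  then show ?thesis
  proof cases
    case 1
    then show ?thesis by (simp add: eq integral_wavelet_finer)
  next
    case 2
    then show ?thesis
      using integral_wavelet_finer[OF 2, of "S_pow k n" "S_pow j m"]
      by (simp add: eq mult.commute)
  next
    case 3
    then have "S_pow j n \<notin> cell j (S_pow j m)"
      using frac_rep_cell_unique[of n m j] assms by auto
    then show ?thesis unfolding eq using 3 by (simp add: integral_wavelet_disjoint)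
  next
    case 4
    then show ?thesis unfolding eq by (simp add: integral_wavelet_squared powr_add[symmetric])
  qed
qed

lemma haar_family_L2: "haar_family i \<in> L2 \<mu>"
proof -
  obtain j n where i: "i = (j, n)" by force
  have "haar_family i = (\<lambda>x. complex_of_real (2 powr (real_of_int j / 2)) *
     (indicator (cell (j + 1) (S_pow j n)) x - indicator (cell (j + 1) (S_pow j n + shift j)) x))"
    by (simp add: i theta_jn_eq_wavelet wavelet_def fun_eq_iff indicator_def)
  also have "\<dots> \<in> L2 \<mu>"
    by (intro L2_scale L2_diff L2_indicator cell_sets emeasure_cell_finite)
  finally show ?thesis .
qed

lemma haar_family_orthonormal:
  assumes "i \<in> haar_index" "k \<in> haar_index"
  shows "L2_inner \<mu> (haar_family i) (haar_family k) = (if i = k then 1 else 0)"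
proof -
  obtain j m j' n where i: "i = (j, m)" and k: "k = (j', n)" by (cases i, cases k)
  have "L2_inner \<mu> (haar_family i) (haar_family k) =
      complex_of_real (\<integral>x. theta_jn j m x * theta_jn j' n x \<partial>\<mu>)"
    unfolding integral_complex_of_real[symmetric] by (simp add: L2_inner_def i k)
  then show ?thesis using assms theta_jn_orthonormal[of m n j j'] by (simp add: i k)
qed

interpretation span: L2_closed_subspace \<mu> "L2_closed_span \<mu> haar_index haar_family"
  by (rule L2_closed_subspace_closed_span) (rule haar_family_L2)

text \<open>If \<open>A\<close> and \<open>B\<close> are the halves of a cell, then \<open>1\<^sub>A - (1\<^sub>A + 1\<^sub>B)/2 = (1\<^sub>A - 1\<^sub>B)/2\<close>. The sign of the
  multiple of the wavelet depends on which half contains \<open>a\<close>.\<close>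

lemma indicator_cell_minus_parent:
  "(\<lambda>x. indicator (cell (j + 1) a) x - indicator (cell j a) x / 2)
     \<in> L2_closed_span \<mu> haar_index haar_family"
proof -
  obtain n where n: "n \<in> frac_reps_plane" "a \<in> cell j (S_pow j n)" using ex_frac_rep_cell by blast
  define b where "b = S_pow j n"
  define c where "c = complex_of_real (2 powr (real_of_int j / 2))"
  have c: "c \<noteq> 0" by (simp add: c_def)
  have \<theta>: "haar_family (j, n) \<in> L2_closed_span \<mu> haar_index haar_family"
    using n(1) by (intro basis_in_L2_closed_span haar_family_L2) simp
  have \<theta>_eq: "complex_of_real (theta_jn j n x) = c * (indicator (cell (j + 1) b) x - indicator (cell (j + 1) (b + shift j)) x)" for x
    by (simp add: theta_jn_eq_wavelet wavelet_def b_def c_def indicator_def)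
  have parent: "cell j a = cell j b" using n(2) cell_eq by (simp add: b_def)
  have "a \<in> cell (j + 1) b \<or> a \<in> cell (j + 1) (b + shift j)"
    using n(2) cell_split(1)[of j b] by (auto simp: b_def)
  then consider "cell (j + 1) a = cell (j + 1) b" | "cell (j + 1) a = cell (j + 1) (b + shift j)"
    using cell_eq by blast
  then obtain s :: complex where "\<And>x. indicator (cell (j + 1) a) x - indicator (cell j a) x / 2
      = s / (2 * c) * haar_family (j, n) x"
  proof cases
    case 1
    then show ?thesis using c
      by (intro that[of 1]) (simp add: \<theta>_eq parent indicator_cell_split[of j b] field_simps)
  next
    case 2
    then show ?thesis using c
      by (intro that[of "-1"]) (simp add: \<theta>_eq parent indicator_cell_split[of j b] field_simps)
  qed
  then show ?thesis using span.scale[OF \<theta>, of "s / (2 * c)"] by simp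
qed

lemma indicator_cell_minus_ancestor:
  "(\<lambda>x. indicator (cell j a) x - indicator (cell (j - int K) a) x / 2 ^ K)
     \<in> L2_closed_span \<mu> haar_index haar_family"
proof (induction K)
  case 0
  then show ?case using span.zero by simp
next
  case (Suc K)
  have "(\<lambda>x. (indicator (cell j a) x - indicator (cell (j - int K) a) x / 2 ^ K)
      + 1 / 2 ^ K * (indicator (cell (j - int (Suc K) + 1) a) x - indicator (cell (j - int (Suc K)) a) x / 2))
      \<in> L2_closed_span \<mu> haar_index haar_family"
    by (intro span.add Suc span.scale indicator_cell_minus_parent)
  moreover have "j - int (Suc K) + 1 = j - int K" by simp
  ultimately show ?case by (simp add: field_simps)
qed

text \<open>The remainder of the preceding lemma has squared norm \<open>2\<^sup>-\<^sup>2\<^sup>K 2\<^sup>K\<^sup>-\<^sup>j = 2\<^sup>-\<^sup>K 2\<^sup>-\<^sup>j\<close>: the factor \<open>2\<^sup>-\<^sup>K\<close>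
  outweighs the growing measure of the ancestor.\<close>

lemma indicator_cell_in_span:
  "indicator (cell j a) \<in> L2_closed_span \<mu> haar_index haar_family"
proof (rule span.closed)
  show "indicator (cell j a) \<in> L2 \<mu>"
    by (intro L2_indicator cell_sets emeasure_cell_finite)
  fix \<epsilon> :: real assume "\<epsilon> > 0"
  define C where "C = (2 :: real) powr - real_of_int j"
  have "C > 0" by (simp add: C_def)
  then have "\<epsilon> / C > 0" using \<open>\<epsilon> > 0\<close> by simp
  then obtain K where K: "(1 / 2) ^ K < \<epsilon> / C"
    using real_arch_pow_inv[of "\<epsilon> / C" "1 / 2"] by auto
  define g :: "q2^2 \<Rightarrow> complex"
    where "g x = indicator (cell j a) x - indicator (cell (j - int K) a) x / 2 ^ K" for x
  have "(\<integral>x. (cmod (indicator (cell j a) x - g x))\<^sup>2 \<partial>\<mu>)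
      = (\<integral>x. (1 / 2 ^ K)\<^sup>2 * indicator (cell (j - int K) a) x \<partial>\<mu>)"
    by (intro Bochner_Integration.integral_cong)
       (auto simp: g_def indicator_def norm_divide norm_power power_divide)
  also have "\<dots> = (1 / 2 ^ K)\<^sup>2 * 2 powr (real K - real_of_int j)"
    by (simp add: measure_cell space_eq)
  also have "\<dots> = (1 / 2) ^ K * C"
    by (simp add: C_def powr_diff powr_minus powr_realpow power2_eq_square field_simps)
  also have "\<dots> < \<epsilon>" using K \<open>C > 0\<close> by (simp add: field_simps)
  finally have "(\<integral>x. (cmod (indicator (cell j a) x - g x))\<^sup>2 \<partial>\<mu>) < \<epsilon>" .
  moreover have "g \<in> L2_closed_span \<mu> haar_index haar_family"
    using indicator_cell_minus_ancestor[of j a K] by (simp only: g_def[abs_def])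
  ultimately show "\<exists>g\<in>L2_closed_span \<mu> haar_index haar_family.
      (\<integral>x. (cmod (indicator (cell j a) x - g x))\<^sup>2 \<partial>\<mu>) < \<epsilon>" by blast
qed

lemma haar_family_total: "L2_closed_span \<mu> haar_index haar_family = L2 \<mu>"
proof (rule span.eq_L2_if_indicators)
  fix A assume A: "A \<in> sets \<mu>" "emeasure \<mu> A < \<infinity>"
  show "indicator A \<in> L2_closed_span \<mu> haar_index haar_family"
  proof (rule span.indicator_from_generator)
    show "sets \<mu> = sigma_sets UNIV (insert {} cells)"
      unfolding sets_eq by (rule borel_plane_eq_sigma_cells)
    show "Int_stable (insert {} cells)" by (rule Int_stable_cells)
    show "emeasure \<mu> B < \<infinity>" if "B \<in> insert {} cells" for B
      using that by (auto simp: cells_def emeasure_cell)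
    show "indicator B \<in> L2_closed_span \<mu> haar_index haar_family" if "B \<in> insert {} cells" for B
      using that indicator_cell_in_span span.zero
      by (auto simp: cells_def indicator_def[of "{}", abs_def])
    show "countable cells" by (rule countable_cells)
    show "\<Union>cells = UNIV" using cell_self cell_in_cells by blast
  qed (use A in auto)
qed

end

theorem theorem9:
  fixes \<mu> :: "(q2^2) measure"
  assumes "haar_measure \<mu>" and "emeasure \<mu> Z2_plane = 1"
  shows "L2_orthonormal_basis \<mu> (UNIV \<times> frac_reps_plane)
           (\<lambda>(j, n) x. complex_of_real (theta_jn j n x))"
proof -
  interpret unit_haar_plane \<mu> by standard (fact assms)+
  show ?thesis
    using haar_family_L2 haar_family_orthonormal haar_family_total
    by (intro L2_orthonormal_basis_if_closed_span) blast+
qed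

end
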